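(* Let $T$ be a caterpillar. Then $\mu_p(T) \le 2$.
   Context: All graphs are finite and simple; the graph $T$ is connected (graphs obtained by deleting a vertex may be disconnected or empty). For a graph $G$, $d_G(u,v)$ is the length of a shortest $u$--$v$ path in $G$, with $d_G(u,v)=\infty$ if $u,v$ lie in different components. A packing coloring of $G$ with $k$ colors is a map $c:V(G)\to\{1,2,\dots,k\}$ such that for every $i\in\{1,\dots,k\}$, any two distinct vertices $u,v$ with $c(u)=c(v)=i$ satisfy $d_G(u,v)>i$. The packing chromatic number $\chi_p(G)$ is the minimum $k$ for which $G$ has such a coloring (the graph with no vertices has $\chi_p=0$). $G-v$ denotes the graph obtained by deleting the vertex $v$. The packing coloring gap of $G$ is $\mu_p(G)=\max_{v\in V(G)}\bigl(\chi_p(G)-\chi_p(G-v)\bigr)$. A caterpillar is a tree in which all vertices of degree at least two lie on a single path (the central path). *)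

theory Defs
  imports "Graph_Theory.Shortest_Path" "Graph_Theory.Digraph_Component"
begin

text \<open>
  Finite simple graphs are the symmetric digraphs of locale \<^locale>\<open>graph\<close>: every undirected
  edge is a pair of opposite arcs. The null graph is allowed.
\<close>

text \<open>
  The infimum over the empty set is \<open>\<infinity>\<close>, so vertices in different components are at
  distance \<open>\<infinity>\<close>.
\<close>

definition graph_dist :: "('a, 'b) pre_digraph \<Rightarrow> 'a \<Rightarrow> 'a \<Rightarrow> enat" where
  "graph_dist G u v = (INF p \<in> {p. pre_digraph.apath G u p v}. enat (length p))"

definition packing_coloring :: "('a, 'b) pre_digraph \<Rightarrow> nat \<Rightarrow> ('a \<Rightarrow> nat) \<Rightarrow> bool" where
  "packing_coloring G k c \<longleftrightarrow>
     c ` verts G \<subseteq> {1..k} \<and>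
     (\<forall>i \<in> {1..k}. \<forall>u \<in> verts G. \<forall>v \<in> verts G.
        u \<noteq> v \<and> c u = i \<and> c v = i \<longrightarrow> enat i < graph_dist G u v)"

definition packing_chromatic_number :: "('a, 'b) pre_digraph \<Rightarrow> nat" where
  "packing_chromatic_number G = (LEAST k. \<exists>c. packing_coloring G k c)"

definition packing_coloring_gap :: "('a, 'b) pre_digraph \<Rightarrow> int" where
  "packing_coloring_gap G =
     Max ((\<lambda>v. int (packing_chromatic_number G) -
               int (packing_chromatic_number (pre_digraph.del_vert G v))) ` verts G)"

text \<open>
  The library predicate \<^const>\<open>tree\<close> cannot be used for symmetric digraphs: it forbids all directed
  cycles, including the closed walk \<open>u, v, u\<close> along an edge and its reverse. The directed cycles
  that come from cycles of the undirected graph are those with at least three arcs.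
\<close>

definition undirected_tree :: "('a, 'b) pre_digraph \<Rightarrow> bool" where
  "undirected_tree G \<longleftrightarrow>
     graph G \<and> Digraph_Component.connected G \<and>
     \<not> (\<exists>p. pre_digraph.cycle G p \<and> 3 \<le> length p)"

text \<open>In a graph of locale \<^locale>\<open>graph\<close> the out-degree of a vertex is its number of neighbours.\<close>

definition caterpillar :: "('a, 'b) pre_digraph \<Rightarrow> bool" where
  "caterpillar G \<longleftrightarrow>
     undirected_tree G \<and>
     (\<exists>u p v. pre_digraph.apath G u p v \<and>
        {w \<in> verts G. 2 \<le> out_degree G w} \<subseteq> set (pre_digraph.awalk_verts G u p))"

lemma (in wf_digraph) graph_dist_conv_\<mu>:
  "ereal_of_enat (graph_dist G u v) = \<mu> (\<lambda>_. 1) u v"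
proof -
  have cost: "awalk_cost (\<lambda>_. 1) p = real (length p)" for p
    by (induct p) auto
  show ?thesis
  proof (cases "\<exists>p. apath u p v")
    case False
    then have "\<nexists>p. awalk u p v"
      using apath_awalk_to_apath by blast
    with False show ?thesis
      by (simp add: graph_dist_def \<mu>_def top_enat_def top_ereal_def)
  next
    case True
    define n where "n = (LEAST n. \<exists>p. apath u p v \<and> length p = n)"
    obtain p where p: "apath u p v" "length p = n"
      using True LeastI_ex[of "\<lambda>n. \<exists>p. apath u p v \<and> length p = n"] unfolding n_def by blast
    have le: "n \<le> length q" if "awalk u q v" for q
    proof -
      have "n \<le> length (awalk_to_apath q)"
        unfolding n_def using apath_awalk_to_apath[OF that] by (intro Least_le) blast
      also have "\<dots> \<le> length q"
      proof -
        have "distinct (awalk_to_apath q)"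
          using apath_awalk_to_apath[OF that]
          by (auto simp: apath_def intro: distinct_verts_imp_distinct)
        then have "length (awalk_to_apath q) = card (set (awalk_to_apath q))"
          by (simp add: distinct_card)
        also have "\<dots> \<le> card (set q)"
          using awalk_to_apath_subset[OF that] by (intro card_mono) auto
        also have "\<dots> \<le> length q"
          by (rule card_length)
        finally show ?thesis .
      qed
      finally show ?thesis .
    qed
    have "graph_dist G u v = enat n"
      unfolding graph_dist_def using p le
      by (intro antisym INF_greatest INF_lower2[of p]) (auto simp: apath_def)
    moreover have "\<mu> (\<lambda>_. 1) u v = ereal (real n)"
      unfolding \<mu>_def using p le
      by (intro antisym INF_greatest INF_lower2[of p]) (auto simp: apath_def cost)
    ultimately show ?thesis by simp
  qed
qed

lemma (in fin_digraph) packing_coloring_exists: "\<exists>k c. packing_coloring G k c"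
proof -
  obtain f where f: "bij_betw f (verts G) {1..card (verts G)}"
    using ex_bij_betw_finite_nat finite_same_card_bij[of "verts G" "{1..card (verts G)}"] by auto
  have "packing_coloring G (card (verts G)) f"
    using f by (auto simp: packing_coloring_def bij_betw_def inj_on_def)
  then show ?thesis by blast
qed

lemma packing_chromatic_number_empty:
  "verts G = {} \<Longrightarrow> packing_chromatic_number G = 0"
  by (simp add: packing_chromatic_number_def packing_coloring_def)

end

theory Submission
  imports Defs
begin

text \<open>
  Let \<open>v\<close> be a vertex of a caterpillar \<open>T\<close> and let \<open>T - v\<close>
  have packing chromatic number \<open>k\<close>. The claim is that \<open>k + 2\<close> colours
  suffice for \<open>T\<close>.

  Two cases are easy. If \<open>v\<close> lies off the central path, it is a leaf, its deletion does
  not change the other distances, and one new colour for \<open>v\<close> is enough. If \<open>k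
  \<ge> 5\<close>, then \<open>k + 2 \<ge> 7\<close>, and every caterpillar has a packing coloring
  with seven colours (\<open>seven_colours\<close>): colour \<open>1\<close> on the leaves and a
  periodic word in \<open>2, \<dots>, 7\<close> on the central path.

  There remains a vertex \<open>v\<close> of the central path with \<open>k \<le> 4\<close>
  (\<open>glue_at_spine_vertex\<close>). A coloring of \<open>T - v\<close> colours the two sides of
  \<open>v\<close>, and it fails in \<open>T\<close> only because of clashes: pairs on opposite
  sides of \<open>v\<close> with the same colour \<open>i\<close> and distance at most
  \<open>i\<close>. As \<open>i \<le> 4\<close>, there is at most one such pair for each colour
  (\<open>clash_unique\<close>). If only one colour clashes, one new colour for \<open>v\<close> and
  another one for an end of the clashing pair solve the problem (\<open>one_clash_colour\<close>).

  If several colours clash, they are \<open>4\<close> and one of \<open>2\<close> and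
  \<open>3\<close>, and \<open>k = 4\<close> (\<open>two_clash_colours\<close>). In a coloring in
  which every leaf has colour \<open>1\<close> whenever its neighbour permits, the vertices close to
  \<open>v\<close> are then so restricted that a few configurations remain up to reflection. In each
  of them it is enough to change the colours of \<open>v\<close> and of some vertices close to it,
  using each of the colours \<open>5\<close> and \<open>6\<close> at most once
  (\<open>two_clashes_recolour\<close>). The delicate ones are those in which the new place of
  colour \<open>2\<close> is too close to an old one; there the old colours \<open>4, 3, 2\<close>
  of three consecutive vertices of the central path force this path to end soon
  (\<open>run_432_ends\<close>), so that nothing further out is in the way.

  For this argument a caterpillar is drawn along a line, with an explicit formula for distances.
  That every caterpillar has such a drawing is \<open>caterpillar_has_drawing\<close>.
\<close>

section \<open>Caterpillars drawn along a line\<close>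

text \<open>
  A caterpillar is drawn along the integer line: \<open>pos\<close> is the position on the central path (the
  spine), and \<open>ht\<close> is \<open>0\<close> on the spine and \<open>1\<close> at a leaf that hangs from the spine vertex at the same
  position. For distinct vertices the formula is their distance in the tree; two leaves at the same
  spine vertex are at distance \<open>2\<close>, and the value at a pair \<open>u = w\<close> has no meaning.
\<close>

definition frame_dist :: "('a \<Rightarrow> int) \<Rightarrow> ('a \<Rightarrow> int) \<Rightarrow> 'a \<Rightarrow> 'a \<Rightarrow> int" where
  "frame_dist pos ht u w = \<bar>pos u - pos w\<bar> + ht u + ht w"

text \<open>
  Colourings of a part \<open>W\<close> of the vertices, with the distances of the whole caterpillar: paths may
  leave \<open>W\<close>. So a colouring can be built up by adding vertices to \<open>W\<close>.
\<close>

definition proper ::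
  "('a \<Rightarrow> int) \<Rightarrow> ('a \<Rightarrow> int) \<Rightarrow> nat \<Rightarrow> 'a set \<Rightarrow> ('a \<Rightarrow> nat) \<Rightarrow> bool" where
  "proper pos ht k W c \<longleftrightarrow> c ` W \<subseteq> {1..k} \<and>
     (\<forall>u\<in>W. \<forall>w\<in>W. u \<noteq> w \<and> c u = c w \<longrightarrow> int (c u) < frame_dist pos ht u w)"

lemma frame_dist_commute: "frame_dist pos ht u w = frame_dist pos ht w u"
  by (simp add: frame_dist_def)

lemma frame_dist_reflect: "frame_dist (\<lambda>u. - pos u) ht = frame_dist pos ht"
  by (intro ext) (simp add: frame_dist_def)

lemma proper_reflect: "proper (\<lambda>u. - pos u) ht = proper pos ht"
  by (intro ext) (simp add: proper_def frame_dist_reflect)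

lemma proper_insert:
  assumes "proper pos ht k W c" "x \<notin> W" "1 \<le> i" "i \<le> k"
    and "\<And>u. u \<in> W \<Longrightarrow> c u = i \<Longrightarrow> int i < frame_dist pos ht u x"
  shows "proper pos ht k (insert x W) (c(x := i))"
proof -
  have W: "int (c u) < frame_dist pos ht u w" if "u \<in> W" "w \<in> W" "u \<noteq> w" "c u = c w" for u w
    using assms(1) that unfolding proper_def by blast
  have x: "int i < frame_dist pos ht u x \<and> int i < frame_dist pos ht x u" if "u \<in> W" "c u = i" for u
    using assms(5)[OF that] by (simp add: frame_dist_def abs_minus_commute)
  have "u \<noteq> x" if "u \<in> W" for u using assms(2) that by blast
  then have "int ((c(x := i)) u) < frame_dist pos ht u w"
    if "u \<in> insert x W" "w \<in> insert x W" "u \<noteq> w" "(c(x := i)) u = (c(x := i)) w" for u w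
    using that W x by (cases "u = x"; cases "w = x") simp_all
  moreover have "(c(x := i)) u \<in> {1..k}" if "u \<in> insert x W" for u
    using assms(1,3,4) that unfolding proper_def by auto
  ultimately show ?thesis unfolding proper_def by blast
qed

lemma proper_mono:
  assumes "proper pos ht k W c" "k \<le> k'"
  shows "proper pos ht k' W c"
proof -
  have "{1..k} \<subseteq> {1..k'}" using assms(2) by simp
  with assms(1) show ?thesis unfolding proper_def by blast
qed

text \<open>
  The last assumption makes the spine an interval of positions. Its case \<open>u = w\<close>, \<open>j = pos u\<close> gives
  every leaf a spine vertex to hang from.
\<close>

locale caterpillar_frame =
  fixes V :: "'a set" and pos :: "'a \<Rightarrow> int" and ht :: "'a \<Rightarrow> int"
  assumes ht_cases: "u \<in> V \<Longrightarrow> ht u = 0 \<or> ht u = 1"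
    and spine_inj: "\<lbrakk>u \<in> V; w \<in> V; ht u = 0; ht w = 0; pos u = pos w\<rbrakk> \<Longrightarrow> u = w"
    and spine_between: "\<lbrakk>u \<in> V; w \<in> V; pos u \<le> j; j \<le> pos w\<rbrakk> \<Longrightarrow> \<exists>x\<in>V. ht x = 0 \<and> pos x = j"
begin

lemma reflect: "caterpillar_frame V (\<lambda>u. - pos u) ht"
proof
  fix u w j assume "u \<in> V" "w \<in> V" "- pos u \<le> j" "j \<le> - pos w"
  then have "\<exists>x\<in>V. ht x = 0 \<and> pos x = - j"
    by (intro spine_between[of w u]) auto
  then show "\<exists>x\<in>V. ht x = 0 \<and> - pos x = j" by force
qed (simp_all add: ht_cases spine_inj)

lemma shift: "caterpillar_frame V (\<lambda>u. pos u - s) ht"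
proof
  fix u w j assume "u \<in> V" "w \<in> V" "pos u - s \<le> j" "j \<le> pos w - s"
  then have "\<exists>x\<in>V. ht x = 0 \<and> pos x = j + s"
    by (intro spine_between[of u w]) auto
  then show "\<exists>x\<in>V. ht x = 0 \<and> pos x - s = j" by force
qed (simp_all add: ht_cases spine_inj)

section \<open>Seven colours suffice\<close>

text \<open>
  All leaves get colour \<open>1\<close> and the spine repeats the word \<open>2 3 4 2 5 3 6 7\<close>. In it colour \<open>2\<close>
  recurs after \<open>3\<close> or \<open>5\<close> steps, colour \<open>3\<close> after \<open>4\<close> steps, and each other colour after \<open>8\<close> steps.
  Without colour \<open>1\<close> on the spine no leaf is adjacent to a vertex of its own colour.
\<close>

lemma seven_colours: "\<exists>c. proper pos ht 7 V c"
proof -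
  define pat :: "nat list" where "pat = [2, 3, 4, 2, 5, 3, 6, 7]"
  have pat_all: "\<forall>r\<in>set [0..<8]. 2 \<le> pat ! r \<and> pat ! r \<le> 7 \<and>
      (\<forall>t\<in>set [1..<8]. pat ! r = pat ! ((r + t) mod 8) \<longrightarrow> pat ! r < t)"
    unfolding pat_def by code_simp
  have pat: "2 \<le> pat ! r" "pat ! r \<le> 7" if "r < 8" for r
    using pat_all that by simp_all
  have pat_repeat: "pat ! r < t"
    if "r < 8" "1 \<le> t" "t < 8" "pat ! r = pat ! ((r + t) mod 8)" for r t
  proof -
    have "r \<in> set [0..<8]" "t \<in> set [1..<8]" using that by simp_all
    with pat_all that(4) show ?thesis by blast
  qed
  define s where "s j = pat ! nat (j mod 8)" for j :: int
  have s8: "nat (i mod 8) < 8" for i :: int by linarith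
  have s_range: "2 \<le> s j" "s j \<le> 7" for j
    using pat[OF s8[of j]] by (simp_all add: s_def)
  have lt: "int (s i) < j - i" if "i < j" "s i = s j" for i j
  proof (cases "j - i \<le> 7")
    case True
    define t where "t = nat (j - i)"
    have "nat (j mod 8) = (nat (i mod 8) + t) mod 8"
    proof -
      have "j mod 8 = (i mod 8 + (j - i)) mod 8" by (simp add: mod_add_left_eq)
      then have "int (nat (j mod 8)) = int ((nat (i mod 8) + t) mod 8)"
        using that(1) by (simp add: t_def zmod_int)
      then show ?thesis by linarith
    qed
    then have "pat ! nat (i mod 8) = pat ! ((nat (i mod 8) + t) mod 8)"
      using that(2) by (simp add: s_def)
    moreover have "1 \<le> t" "t < 8" using that True by (simp_all add: t_def)
    ultimately have "s i < t"
      unfolding s_def by (intro pat_repeat s8)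
    then show ?thesis using that by (simp add: t_def)
  next
    case False
    then show ?thesis using s_range(2)[of i] by linarith
  qed
  define c where "c u = (if ht u = 0 then s (pos u) else 1)" for u
  have "int (c u) < frame_dist pos ht u w" if "u \<in> V" "w \<in> V" "u \<noteq> w" "c u = c w" for u w
  proof (cases "ht u = 0")
    case True
    with that(4) s_range(1)[of "pos u"] have w: "ht w = 0" "s (pos u) = s (pos w)"
      by (auto simp: c_def split: if_splits)
    then have "pos u \<noteq> pos w" using spine_inj that True by blast
    then show ?thesis
      using lt[of "pos u" "pos w"] lt[of "pos w" "pos u"] w True
      by (cases "pos u < pos w") (auto simp: c_def frame_dist_def)
  next
    case False
    with that(4) s_range(1)[of "pos w"] have "ht w \<noteq> 0" by (auto simp: c_def split: if_splits)
    with False ht_cases[OF that(1)] ht_cases[OF that(2)] show ?thesis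
      by (auto simp: c_def frame_dist_def)
  qed
  moreover have "1 \<le> c u \<and> c u \<le> 7" for u
    using s_range[of "pos u"] by (auto simp: c_def)
  ultimately have "proper pos ht 7 V c"
    unfolding proper_def by (metis atLeastAtMost_iff image_subsetI)
  then show ?thesis by blast
qed

end

section \<open>Two sides of a spine vertex and their clashes\<close>

text \<open>
  The vertex \<open>v\<close> to be reinserted lies on the spine at position \<open>0\<close>, and \<open>c\<close> colours the rest so that
  each of the two sides is properly coloured by itself. The last assumption is a normalisation: a
  leaf can always take colour \<open>1\<close> unless its neighbour has it. After that, a colour other than \<open>1\<close> on
  the spine is the only such colour at its position, which makes the neighbourhood of \<open>v\<close> easy to
  survey.
\<close>

locale cut_frame = caterpillar_frame +
  fixes v :: 'a and c :: "'a \<Rightarrow> nat" and k :: nat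
  assumes v: "v \<in> V" "ht v = 0" "pos v = 0"
    and k: "k \<le> 4"
    and colour: "\<lbrakk>u \<in> V; u \<noteq> v\<rbrakk> \<Longrightarrow> 1 \<le> c u \<and> c u \<le> k"
    and same_side: "\<lbrakk>u \<in> V; w \<in> V; u \<noteq> w; pos u < 0 \<and> pos w < 0 \<or> 0 < pos u \<and> 0 < pos w; c u = c w\<rbrakk>
      \<Longrightarrow> int (c u) < frame_dist pos ht u w"
    and leaf_one: "\<lbrakk>u \<in> V; ht u = 1; w \<in> V; ht w = 0; pos w = pos u; w = v \<or> c w \<noteq> 1\<rbrakk> \<Longrightarrow> c u = 1"
begin

lemma reflect_cut: "cut_frame V (\<lambda>u. - pos u) ht v c k"
proof (intro cut_frame.intro cut_frame_axioms.intro reflect)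
  fix u w assume "u \<in> V" "w \<in> V" "u \<noteq> w" "c u = c w"
    and "- pos u < 0 \<and> - pos w < 0 \<or> 0 < - pos u \<and> 0 < - pos w"
  then show "int (c u) < frame_dist (\<lambda>u. - pos u) ht u w"
    unfolding frame_dist_reflect by (intro same_side) auto
next
  fix u w assume "u \<in> V" "ht u = 1" "w \<in> V" "ht w = 0" "- pos w = - pos u" "w = v \<or> c w \<noteq> 1"
  then show "c u = 1" by (intro leaf_one[of u w]) auto
next
  fix u assume "u \<in> V" "u \<noteq> v"
  then show "1 \<le> c u \<and> c u \<le> k" by (rule colour)
qed (simp_all add: v k)

text \<open>
  The pairs that spoil \<open>c\<close> once \<open>v\<close> connects the two sides. The last condition is
  \<open>frame_dist pos ht x y \<le> c x\<close>, with the absolute value resolved by the signs of the positions.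
\<close>

definition clash :: "'a \<Rightarrow> 'a \<Rightarrow> bool" where
  "clash x y \<longleftrightarrow> x \<in> V \<and> y \<in> V \<and> pos x < 0 \<and> 0 < pos y \<and> c x = c y \<and>
     pos y - pos x + ht x + ht y \<le> int (c x)"

lemma clash_colour: "clash x y \<Longrightarrow> 2 \<le> c x \<and> c x \<le> k"
  using colour[of x] ht_cases[of x] ht_cases[of y] v unfolding clash_def by (cases "x = v") auto

text \<open>
  Let \<open>i \<le> 4\<close> be the clashing colour. The two left ends have distance at most \<open>i - 1\<close> from \<open>v\<close>, hence at
  most \<open>i - 2\<close> from the left neighbour of \<open>v\<close>, hence at most \<open>2 * (i - 2) \<le> i\<close> from each other. So they
  coincide, because the left side is properly coloured. The same holds on the right.
\<close>

lemma clash_unique: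
  assumes "clash x y" "clash x' y'" "c x = c x'"
  shows "x = x'" "y = y'"
proof -
  have 4: "int (c x) \<le> 4" using clash_colour[OF assms(1)] k by simp
  have V: "x \<in> V" "y \<in> V" "x' \<in> V" "y' \<in> V" using assms by (auto simp: clash_def)
  note h = V[THEN ht_cases]
  have le: "pos x < 0" "0 < pos y" "pos y - pos x + ht x + ht y \<le> int (c x)"
      "pos x' < 0" "0 < pos y'" "pos y' - pos x' + ht x' + ht y' \<le> int (c x)"
    using assms by (auto simp: clash_def)
  have "frame_dist pos ht x x' \<le> int (c x)"
    using le h 4 unfolding frame_dist_def by linarith
  then show "x = x'" using same_side[of x x'] V le assms(3) by linarith
  have "frame_dist pos ht y y' \<le> int (c x)"
    using le h 4 unfolding frame_dist_def by linarith
  moreover have "c y = c x" "c y' = c x" using assms by (auto simp: clash_def)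
  ultimately show "y = y'" using same_side[of y y'] V le by linarith
qed

lemma beside_v:
  assumes "u \<in> V" "u \<noteq> v" "pos u = 0"
  shows "ht u = 1 \<and> c u = 1"
  using ht_cases[OF assms(1)] spine_inj[OF assms(1) v(1)] leaf_one[OF assms(1) _ v(1)] assms v by auto

text \<open>
  Between vertices other than \<open>v\<close>, clashes are the only obstruction: the leaves at \<open>v\<close> have colour \<open>1\<close>
  and no neighbour except \<open>v\<close>.
\<close>

lemma proper_if_no_clash:
  assumes "W \<subseteq> V - {v}" "\<And>x y. clash x y \<Longrightarrow> x \<notin> W \<or> y \<notin> W"
  shows "proper pos ht k W c"
proof -
  have "int (c u) < frame_dist pos ht u w"
    if uw: "u \<in> W" "w \<in> W" "u \<noteq> w" "c u = c w" "pos u \<le> pos w" for u w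
  proof -
    have V: "u \<in> V" "w \<in> V" "u \<noteq> v" "w \<noteq> v" using uw assms(1) by auto
    note h = ht_cases[OF V(1)] ht_cases[OF V(2)]
    note zero = beside_v
    consider "pos u < 0 \<and> pos w < 0 \<or> 0 < pos u \<and> 0 < pos w" | "pos u = 0" | "pos w = 0"
      | "pos u < 0" "0 < pos w"
      using uw by linarith
    then show ?thesis
    proof cases
      case 1 then show ?thesis using same_side V uw by blast
    next
      case 2
      have "int (c u) = 1" "ht u = 1" "pos w = 0 \<Longrightarrow> ht w = 1"
        using zero[of u] zero[of w] V 2 uw(4) by simp_all
      then show ?thesis using 2 h unfolding frame_dist_def by (cases "pos w = 0") linarith+
    next
      case 3
      have "int (c u) = 1" "ht w = 1" "pos u = 0 \<Longrightarrow> ht u = 1"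
        using zero[of w] zero[of u] V 3 uw(4) by simp_all
      then show ?thesis using 3 h unfolding frame_dist_def by (cases "pos u = 0") linarith+
    next
      case 4
      then have "\<not> pos w - pos u + ht u + ht w \<le> int (c u)"
        using assms(2)[of u w] V uw by (auto simp: clash_def)
      then show ?thesis using 4 by (simp add: frame_dist_def)
    qed
  qed
  note ordered = this
  have "int (c u) < frame_dist pos ht u w" if "u \<in> W" "w \<in> W" "u \<noteq> w" "c u = c w" for u w
  proof (cases "pos u \<le> pos w")
    case True then show ?thesis using ordered that by blast
  next
    case False
    then have "int (c w) < frame_dist pos ht w u" using ordered[of w u] that by simp
    then show ?thesis using that(4) by (simp add: frame_dist_commute[of pos ht u])
  qed
  moreover have "c u \<in> {1..k}" if "u \<in> W" for u using colour[of u] assms(1) that by auto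
  ultimately show ?thesis unfolding proper_def by blast
qed

text \<open>
  Two new colours are enough for a single clashing pair: one for \<open>v\<close> and one for the left end \<open>z\<close> of
  the pair.
\<close>

lemma one_clash_colour:
  assumes "\<And>x y x' y'. clash x y \<Longrightarrow> clash x' y' \<Longrightarrow> c x = c x'"
  shows "\<exists>c'. proper pos ht (k + 2) V c'"
proof -
  obtain z where z: "z \<in> V" "\<And>x y. clash x y \<Longrightarrow> x = z"
  proof (cases "\<exists>x y. clash x y")
    case True
    then obtain x y where xy: "clash x y" by blast
    show ?thesis
    proof (rule that)
      show "x \<in> V" using xy by (simp add: clash_def)
      show "x' = x" if "clash x' y'" for x' y'
        using clash_unique(1)[OF that xy] assms[OF that xy] .
    qed
  next
    \<comment> \<open>Without clashes \<open>z\<close> may be any vertex; \<open>v\<close> itself is a convenient default.\<close>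
    case False
    show ?thesis by (rule that[of v]) (use v False in blast)+
  qed
  have fresh: "c u \<noteq> k + 1 \<and> c u \<noteq> k + 2" if "u \<in> V - {v, z}" for u
    using colour[of u] that by auto
  have "proper pos ht (k + 2) (V - {v, z}) c"
    by (rule proper_mono[OF proper_if_no_clash]) (auto dest: z(2))
  then have 1: "proper pos ht (k + 2) (insert z (V - {v, z})) (c(z := k + 2))"
    by (rule proper_insert) (use fresh in auto)
  show ?thesis
  proof (cases "z = v")
    case True
    then have "insert z (V - {v, z}) = V" using v by blast
    with 1 show ?thesis by metis
  next
    case False
    have "proper pos ht (k + 2) (insert v (insert z (V - {v, z}))) (c(z := k + 2, v := k + 1))"
      by (rule proper_insert[OF 1]) (use fresh False in \<open>auto split: if_splits\<close>)
    moreover have "insert v (insert z (V - {v, z})) = V" using v z by blast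
    ultimately show ?thesis by metis
  qed
qed

lemma clash_reflect: "cut_frame.clash V (\<lambda>u. - pos u) ht c y x \<longleftrightarrow> clash x y"
  unfolding cut_frame.clash_def[OF reflect_cut] clash_def by auto

lemma beside_coloured:
  assumes "x \<in> V" "ht x = 0" "x \<noteq> v" "c x \<noteq> 1" "u \<in> V" "pos u = pos x"
  shows "u = x \<or> ht u = 1 \<and> c u = 1"
  using ht_cases[OF assms(5)] spine_inj[OF assms(5,1)] leaf_one[OF assms(5) _ assms(1)] assms by auto

lemma column_of_coloured:
  assumes "x \<in> V" "ht x = 0" "x \<noteq> v" "c x \<noteq> 1" "u \<in> V" "c u \<noteq> 1" "u \<noteq> x"
  shows "pos u \<noteq> pos x"
  using beside_coloured[OF assms(1-5)] assms(6,7) by blast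

lemma column_of_v:
  assumes "u \<in> V" "u \<noteq> v" "c u \<noteq> 1"
  shows "pos u \<noteq> 0"
  using beside_v[OF assms(1,2)] assms(3) by blast

lemma same_side_right:
  assumes "x \<in> V" "u \<in> V" "0 < pos x" "0 < pos u" "u \<noteq> x" "c u = c x"
  shows "int (c x) < \<bar>pos u - pos x\<bar> + ht u + ht x"
  using same_side[of u x] assms by (simp add: frame_dist_def)

lemma clash_bounds:
  assumes "clash x y"
  shows "x \<in> V" "y \<in> V" "x \<noteq> v" "y \<noteq> v" "c y = c x" "pos x < 0" "0 < pos y" "0 \<le> ht x" "0 \<le> ht y"
    "ht x \<le> 1" "ht y \<le> 1" "pos y - pos x + ht x + ht y \<le> int (c x)"
  using assms ht_cases[of x] ht_cases[of y] v unfolding clash_def by auto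

lemma clash_2_shape:
  assumes "clash x y" "c x = 2"
  shows "pos x = -1" "ht x = 0" "pos y = 1" "ht y = 0"
  using clash_bounds[OF assms(1)] assms(2) by linarith+

text \<open>
  A clash of colour \<open>2\<close> occupies both neighbours of \<open>v\<close>. Then vertices of colour \<open>3\<close> are at distance
  at least \<open>2\<close> from \<open>v\<close>, so those on opposite sides are at distance at least \<open>4\<close>.
\<close>

lemma clash_2_3_exclusive:
  assumes "clash x y" "clash x' y'" "c x = 2" "c x' = 3"
  shows False
proof -
  note b = clash_bounds[OF assms(1)] and b' = clash_bounds[OF assms(2)]
  note s = clash_2_shape[OF assms(1,3)]
  have "pos x' \<noteq> -1" using beside_coloured[of x x'] b b' s assms by auto
  moreover have "pos y' \<noteq> 1" using beside_coloured[of y y'] b b' s assms by auto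
  ultimately show False using b' assms(4) by linarith
qed

section \<open>Two clashing colours\<close>

text \<open>
  As colour \<open>1\<close> never clashes and colours \<open>2\<close> and \<open>3\<close> exclude each other, two different clashing
  colours are \<open>2, 4\<close> or \<open>3, 4\<close>, and there is no third one. Since colour \<open>4\<close> is in use, \<open>k = 4\<close>: six
  colours are available.
\<close>

lemma two_clash_colours:
  assumes "clash x y" "clash x' y'" "c x < c x'"
  shows "c x' = 4" "c x = 2 \<or> c x = 3" "k = 4"
    "clash x'' y'' \<Longrightarrow> (x'' = x \<and> y'' = y) \<or> (x'' = x' \<and> y'' = y')"
proof -
  have r: "2 \<le> c x \<and> c x \<le> k" "2 \<le> c x' \<and> c x' \<le> k"
    using clash_colour assms by blast+
  have "\<not> (c x = 2 \<and> c x' = 3)" using clash_2_3_exclusive[OF assms(1,2)] by blast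
  then show 4: "c x' = 4" using r k assms(3) by arith
  show k4: "k = 4" using r k 4 by linarith
  show "c x = 2 \<or> c x = 3" using r k assms(3) by linarith
  assume c'': "clash x'' y''"
  have "\<not> (c x = 2 \<and> c x'' = 3)" "\<not> (c x'' = 2 \<and> c x = 3)"
    using clash_2_3_exclusive[OF assms(1) c''] clash_2_3_exclusive[OF c'' assms(1)] by blast+
  then have "c x'' = c x \<or> c x'' = c x'"
    using clash_colour[OF c''] r k 4 assms(3) by arith
  then show "(x'' = x \<and> y'' = y) \<or> (x'' = x' \<and> y'' = y')"
    using clash_unique[OF c''] assms by blast
qed

lemma proper_without_witnesses:
  assumes "clash x y" "clash x' y'" "c x < c x'"
    and "W \<subseteq> V - {v}" "x \<notin> W \<or> y \<notin> W" "x' \<notin> W \<or> y' \<notin> W"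
  shows "proper pos ht 6 W c"
proof (rule proper_mono)
  show "proper pos ht k W c"
    using proper_if_no_clash[OF assms(4)] two_clash_colours(4)[OF assms(1-3)] assms(5,6) by blast
  show "k \<le> 6" using k by simp
qed

lemma fresh_colours: "u \<in> V \<Longrightarrow> u \<noteq> v \<Longrightarrow> c u \<noteq> 5 \<and> c u \<noteq> 6"
  using colour[of u] k by linarith

text \<open>
  The common form of the local repairs. The vertices of a small set \<open>X\<close>, which contains \<open>v\<close> and one
  end of each clashing pair, get pairwise different new colours \<open>f\<close>. No clash is left among the
  other vertices, and only the new colours up to \<open>4\<close> have to be compared with the old ones, since \<open>5\<close> and \<open>6\<close> are
  fresh.
\<close>

lemma recolour_witnesses:
  assumes "clash x y" "clash x' y'" "c x < c x'"
    and X: "X \<subseteq> V" "v \<in> X" "x \<in> X \<or> y \<in> X" "x' \<in> X \<or> y' \<in> X"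
    and f: "inj_on f X" "f ` X \<subseteq> {1..6}"
    and far: "\<And>a u. \<lbrakk>a \<in> X; f a \<le> 4; u \<in> V - X; c u = f a\<rbrakk> \<Longrightarrow> int (f a) < frame_dist pos ht u a"
  shows "\<exists>c'. proper pos ht 6 V c'"
proof -
  have old: "proper pos ht 6 (V - X) c"
    by (rule proper_without_witnesses[OF assms(1-3)]) (use X in auto)
  define c' where "c' u = (if u \<in> X then f u else c u)" for u
  have mixed: "int (f a) < frame_dist pos ht u a" if "a \<in> X" "u \<in> V - X" "c u = f a" for a u
  proof -
    have "c u \<le> k" using colour[of u] that(2) X(2) by auto
    then have "f a \<le> 4" using k that(3) by linarith
    then show ?thesis using far that by blast
  qed
  have "int (c' u) < frame_dist pos ht u w"
    if "u \<in> V" "w \<in> V" "u \<noteq> w" "c' u = c' w" for u w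
  proof (cases "u \<in> X"; cases "w \<in> X")
    assume "u \<in> X" "w \<in> X"
    then show ?thesis using that(3,4) f(1) by (auto simp: c'_def inj_on_def)
  next
    assume *: "u \<in> X" "w \<notin> X"
    then have "int (f u) < frame_dist pos ht w u" using mixed[of u w] that by (simp add: c'_def)
    then show ?thesis using * frame_dist_commute[of pos ht u w] by (simp add: c'_def)
  next
    assume *: "u \<notin> X" "w \<in> X"
    then have "int (f w) < frame_dist pos ht u w" using mixed[of w u] that by (simp add: c'_def)
    then show ?thesis using * that(4) by (simp add: c'_def)
  next
    assume *: "u \<notin> X" "w \<notin> X"
    then have "c u = c w" using that(4) by (simp add: c'_def)
    then have "int (c u) < frame_dist pos ht u w" using old that(1-3) * unfolding proper_def by blast
    then show ?thesis using * by (simp add: c'_def)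
  qed
  moreover have "c' u \<in> {1..6}" if "u \<in> V" for u
  proof (cases "u \<in> X")
    case True
    then show ?thesis using f(2) by (auto simp: c'_def)
  next
    case False
    then have "c u \<in> {1..6}" using old that unfolding proper_def by blast
    then show ?thesis using False by (simp add: c'_def)
  qed
  ultimately have "proper pos ht 6 V c'" unfolding proper_def by blast
  then show ?thesis by blast
qed

lemma clash_4_shape:
  assumes "clash x y" "clash x' y'" "pos x = -1" "ht x = 0" "pos y = 1" "ht y = 0" "c x < 4" "c x' = 4"
  shows "pos x' = -2" "ht x' = 0" "pos y' = 2" "ht y' = 0"
proof -
  note b = clash_bounds[OF assms(1)] and b' = clash_bounds[OF assms(2)]
  have "pos x' \<noteq> -1" using column_of_coloured[of x x'] clash_colour[OF assms(1)] b b' assms by (cases "x' = x") auto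
  moreover have "pos y' \<noteq> 1" using column_of_coloured[of y y'] clash_colour[OF assms(1)] b b' assms by (cases "y' = y") auto
  ultimately show "pos x' = -2" "ht x' = 0" "pos y' = 2" "ht y' = 0" using b' assms(8) by linarith+
qed

lemma clash_24_shape:
  assumes "clash x y" "clash x' y'" "c x = 2" "c x' = 4"
  shows "pos x' = -2" "ht x' = 0" "pos y' = 2" "ht y' = 0"
  using clash_4_shape[OF assms(1,2) clash_2_shape[OF assms(1,3)] _ assms(4)] assms(3) by simp_all

text \<open>
  Both neighbours of \<open>v\<close> have the same colour, \<open>2\<close> or \<open>3\<close>, and the next spine vertices have colour \<open>4\<close>.
  So near \<open>v\<close> there is little room for the other colour \<open>j\<close> of \<open>2\<close> and \<open>3\<close>: it does not occur within
  distance \<open>2\<close> of \<open>v\<close>, and within distance \<open>3\<close> only on the spine, which the last assumption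
  excludes for \<open>j = 3\<close>. Hence \<open>v\<close> can take colour \<open>j\<close>, and \<open>5\<close> and \<open>6\<close> resolve the two clashes.
\<close>

lemma adjacent_clash_recolour:
  assumes "clash x y" "clash x' y'" "pos x = -1" "ht x = 0" "pos y = 1" "ht y = 0" "c x < 4" "c x' = 4"
    and j: "2 \<le> j" "j \<le> 3" "c x \<noteq> j"
    and far: "\<And>u. u \<in> V \<Longrightarrow> ht u = 0 \<Longrightarrow> \<bar>pos u\<bar> = 3 \<Longrightarrow> c u = j \<Longrightarrow> j < 3"
  shows "\<exists>c'. proper pos ht 6 V c'"
proof -
  note b = clash_bounds[OF assms(1)] clash_bounds[OF assms(2)]
  note s = assms(3-6) clash_4_shape[OF assms(1-8)]
  have cx: "2 \<le> c x" using clash_colour[OF assms(1)] by blast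
  have ne: "x \<noteq> y'" "x \<noteq> v" "y' \<noteq> v" using assms b by auto
  have 3: "int j < frame_dist pos ht u v" if "u \<in> V - {v, x, y'}" "c u = j" for u
  proof -
    have u: "u \<in> V" "u \<noteq> v" "u \<noteq> x" "u \<noteq> y" "u \<noteq> x'" "u \<noteq> y'"
      using that b assms(8) j by auto
    have "pos u \<noteq> -1" using column_of_coloured[of x u] b s cx j(1) that(2) u by simp
    moreover have "pos u \<noteq> 1" using column_of_coloured[of y u] b s cx j(1) that(2) u by simp
    moreover have "pos u \<noteq> -2" using column_of_coloured[of x' u] b s assms(8) j(1) that(2) u by simp
    moreover have "pos u \<noteq> 2" using column_of_coloured[of y' u] b s assms(8) j(1) that(2) u by simp
    moreover have "pos u \<noteq> 0" using column_of_v[of u] j(1) that(2) u by simp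
    moreover have "ht u = 0 \<Longrightarrow> \<bar>pos u\<bar> = 3 \<Longrightarrow> j < 3" using far[OF u(1)] that(2) by simp
    ultimately show ?thesis
      using ht_cases[OF u(1)] v j unfolding frame_dist_def by arith
  qed
  show ?thesis
  proof (rule recolour_witnesses[OF assms(1,2)])
    show "inj_on ((\<lambda>_. 0 :: nat)(x := 5, y' := 6, v := j)) {v, x, y'}"
      using j(2) ne by (auto simp: inj_on_def)
  qed (use 3 b v j ne assms(7,8) in auto)
qed

text \<open>
  Three consecutive spine vertices with colours \<open>4, 3, 2\<close>, read away from \<open>v\<close>, force the spine to end
  soon. The next spine vertex \<open>p\<close> is too close to each of them and has colour \<open>1\<close>. The vertex \<open>q\<close> after
  it is adjacent to \<open>p\<close> and at distance \<open>2\<close>, \<open>3\<close>, \<open>4\<close> from the vertices coloured \<open>2\<close>, \<open>3\<close>, \<open>4\<close>, so it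
  has no colour at all.
\<close>

lemma run_432_ends:
  assumes "p4 \<in> V" "p3 \<in> V" "p2 \<in> V" "ht p4 = 0" "ht p3 = 0" "ht p2 = 0"
    and "pos p4 = s" "pos p3 = s + 1" "pos p2 = s + 2" "0 < s"
    and "c p4 = 4" "c p3 = 3" "c p2 = 2" "u \<in> V"
  shows "pos u \<le> s + 3"
proof (rule ccontr)
  assume "\<not> pos u \<le> s + 3"
  then obtain p q where p: "p \<in> V" "ht p = 0" "pos p = s + 3" and q: "q \<in> V" "ht q = 0" "pos q = s + 4"
    using spine_between[OF v(1) assms(14), of "s + 3"] spine_between[OF v(1) assms(14), of "s + 4"]
      v assms(10) by auto
  have pv: "p \<noteq> v" "q \<noteq> v" using p q v assms(10) by auto
  have k4: "c p \<le> 4" "1 \<le> c p" "c q \<le> 4" "1 \<le> c q"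
    using colour[OF p(1) pv(1)] colour[OF q(1) pv(2)] k by auto
  have "c p \<noteq> 2" using same_side_right[of p2 p] p assms by (cases "p = p2") auto
  moreover have "c p \<noteq> 3" using same_side_right[of p3 p] p assms by (cases "p = p3") auto
  moreover have "c p \<noteq> 4" using same_side_right[of p4 p] p assms by (cases "p = p4") auto
  ultimately have p1: "c p = 1" using k4 by arith
  have "c q \<noteq> 1" using same_side_right[of p q] p q p1 assms(10) by (cases "q = p") auto
  moreover have "c q \<noteq> 2" using same_side_right[of p2 q] q assms by (cases "q = p2") auto
  moreover have "c q \<noteq> 3" using same_side_right[of p3 q] q assms by (cases "q = p3") auto
  moreover have "c q \<noteq> 4" using same_side_right[of p4 q] q assms by (cases "q = p4") auto
  ultimately show False using k4 by arith
qed

text \<open>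
  The spine has colours \<open>2, 4, 3\<close> at positions \<open>1, 2, 3\<close>, and \<open>v\<close> gets colour \<open>5\<close>. If position \<open>4\<close> does
  not have colour \<open>2\<close>, then positions \<open>1, 2\<close> are recoloured by \<open>6, 2\<close>. Otherwise the colours \<open>4, 3, 2\<close> at
  positions \<open>2, 3, 4\<close> force the spine to end, and positions \<open>1\<close> to \<open>4\<close> can be recoloured by
  \<open>6, 3, 2, 4\<close> without interference from further out.
\<close>

lemma clash_24_recolour_with_3:
  assumes "clash x y" "clash x' y'" "c x = 2" "c x' = 4"
    and z: "z \<in> V" "ht z = 0" "pos z = 3" "c z = 3"
  shows "\<exists>c'. proper pos ht 6 V c'"
proof (cases "\<exists>t\<in>V. ht t = 0 \<and> pos t = 4 \<and> c t = 2")
  case False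
  note b = clash_bounds[OF assms(1)] clash_bounds[OF assms(2)]
  note s = clash_2_shape[OF assms(1,3)] clash_24_shape[OF assms(1-4)]
  have ne: "y \<noteq> y'" "y \<noteq> v" "y' \<noteq> v" using assms b by auto
  have far: "2 < frame_dist pos ht u y'" if "u \<in> V - {v, y, y'}" "c u = 2" for u
  proof -
    have u: "u \<in> V" "u \<noteq> v" "u \<noteq> y" using that by auto
    have z': "z \<noteq> v" using z v by auto
    have "pos u \<noteq> 1" using column_of_coloured[of y u] b s assms(3) that(2) u by (cases "u = y") auto
    moreover have "pos u \<noteq> 2" using column_of_coloured[of y' u] b s assms(4) that(2) u by (cases "u = y'") auto
    moreover have "pos u \<noteq> 3" using column_of_coloured[of z u] z z' that(2) u by (cases "u = z") auto
    moreover have "pos u \<noteq> 0" using column_of_v[of u] that(2) u by auto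
    moreover have "ht u = 0 \<Longrightarrow> pos u \<noteq> 4" using False u(1) that(2) by auto
    ultimately show ?thesis
      using ht_cases[OF u(1)] s unfolding frame_dist_def by arith
  qed
  show ?thesis
  proof (rule recolour_witnesses[OF assms(1,2)])
    show "inj_on ((\<lambda>_. 0 :: nat)(y' := 2, y := 6, v := 5)) {v, y, y'}"
      using ne by (auto simp: inj_on_def)
  qed (use far b v ne assms(3,4) in auto)
next
  case True
  then obtain t where t: "t \<in> V" "ht t = 0" "pos t = 4" "c t = 2" by blast
  note b = clash_bounds[OF assms(1)] clash_bounds[OF assms(2)]
  note s = clash_2_shape[OF assms(1,3)] clash_24_shape[OF assms(1-4)]
  have short: "pos u \<le> 5" if "u \<in> V" for u
    using run_432_ends[of y' z t 2 u] b s z t assms(4) that by simp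
  have ne: "y \<noteq> y'" "y \<noteq> z" "y \<noteq> t" "y' \<noteq> z" "y' \<noteq> t" "z \<noteq> t" "z \<noteq> v" "t \<noteq> v" "y \<noteq> v" "y' \<noteq> v"
    using assms b s t v by auto
  have W: "u \<in> V \<and> u \<noteq> v \<and> u \<noteq> y \<and> u \<noteq> y' \<and> u \<noteq> z \<and> u \<noteq> t" if "u \<in> V - {v, y, y', z, t}" for u
    using that by auto
  have cols: "pos u \<noteq> 0 \<and> pos u \<noteq> 1 \<and> pos u \<noteq> 2 \<and> pos u \<noteq> 3 \<and> pos u \<noteq> 4" if "u \<in> V - {v, y, y', z, t}" "c u \<noteq> 1" for u
    using column_of_v[of u] column_of_coloured[of y u] column_of_coloured[of y' u]
      column_of_coloured[of z u] column_of_coloured[of t u] W[OF that(1)] b s z t ne assms(3,4) that(2)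
    by auto
  have far_y': "3 < frame_dist pos ht u y'" if "u \<in> V - {v, y, y', z, t}" "c u = 3" for u
  proof -
    have u: "u \<in> V" using W[OF that(1)] by blast
    have "pos u \<noteq> -1" using column_of_coloured[of x u] b s assms(3) that(2) u by (cases "u = x") auto
    moreover have "0 < pos u \<Longrightarrow> 3 < \<bar>pos u - 3\<bar> + ht u"
      using same_side_right[of z u] W[OF that(1)] z that(2) by simp
    ultimately show ?thesis
      using cols[of u] that ht_cases[OF u] short[OF u] s unfolding frame_dist_def by arith
  qed
  have far_z: "2 < frame_dist pos ht u z" if "u \<in> V - {v, y, y', z, t}" "c u = 2" for u
  proof -
    have u: "u \<in> V" using W[OF that(1)] by blast
    have "0 < pos u \<Longrightarrow> 2 < \<bar>pos u - 4\<bar> + ht u"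
      using same_side_right[of t u] W[OF that(1)] t that(2) by simp
    then show ?thesis
      using cols[of u] that ht_cases[OF u] short[OF u] z unfolding frame_dist_def by arith
  qed
  have far_t: "4 < frame_dist pos ht u t" if "u \<in> V - {v, y, y', z, t}" "c u = 4" for u
  proof -
    have u: "u \<in> V" using W[OF that(1)] by blast
    have "0 < pos u \<Longrightarrow> 4 < \<bar>pos u - 2\<bar> + ht u"
      using same_side_right[of y' u] W[OF that(1)] b s assms(4) that(2) by simp
    then show ?thesis
      using cols[of u] that ht_cases[OF u] short[OF u] t unfolding frame_dist_def by arith
  qed
  show ?thesis
  proof (rule recolour_witnesses[OF assms(1,2)])
    show "inj_on ((\<lambda>_. 0 :: nat)(y' := 3, z := 2, t := 4, y := 6, v := 5)) {v, y, y', z, t}"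
      using ne by (auto simp: inj_on_def)
  qed (use far_y' far_z far_t z t b v ne assms(3,4) in auto)
qed

text \<open>
  The spine has colours \<open>4, 3\<close> at positions \<open>1, 2\<close>. The repair is \<open>5\<close> for \<open>v\<close> and \<open>2, 6\<close> at positions
  \<open>1, 2\<close>. The new colour \<open>2\<close> is far from the left side because the left neighbour of \<open>v\<close> has colour \<open>3\<close>.
  It is in conflict only with a colour \<open>2\<close> at position \<open>3\<close>; but then the spine ends soon, and position
  \<open>3\<close> can be recoloured by \<open>4\<close>.
\<close>

lemma clash_34_tail_recolour:
  assumes "clash x y" "clash x' y'" "c x = 3" "c x' = 4" "pos x = -1" "ht x = 0"
    and "pos y = 2" "ht y = 0" "pos y' = 1" "ht y' = 0"
  shows "\<exists>c'. proper pos ht 6 V c'"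
proof (cases "\<exists>t\<in>V. ht t = 0 \<and> pos t = 3 \<and> c t = 2")
  case False
  note b = clash_bounds[OF assms(1)] clash_bounds[OF assms(2)]
  have ne: "y \<noteq> y'" "y \<noteq> v" "y' \<noteq> v" using assms b by auto
  have far: "2 < frame_dist pos ht u y'" if "u \<in> V - {v, y, y'}" "c u = 2" for u
  proof -
    have u: "u \<in> V" "u \<noteq> v" "u \<noteq> y" "u \<noteq> y'" "u \<noteq> x" using that assms(3) by auto
    have "pos u \<noteq> -1" using column_of_coloured[of x u] b assms that(2) u by simp
    moreover have "pos u \<noteq> 0" using column_of_v[of u] that(2) u by simp
    moreover have "pos u \<noteq> 1" using column_of_coloured[of y' u] b assms that(2) u by simp
    moreover have "pos u \<noteq> 2" using column_of_coloured[of y u] b assms that(2) u by simp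
    moreover have "ht u = 0 \<Longrightarrow> pos u \<noteq> 3" using False u(1) that(2) by auto
    ultimately show ?thesis
      using ht_cases[OF u(1)] assms(9,10) unfolding frame_dist_def by arith
  qed
  show ?thesis
  proof (rule recolour_witnesses[OF assms(1,2)])
    show "inj_on ((\<lambda>_. 0 :: nat)(y' := 2, y := 6, v := 5)) {v, y, y'}"
      using ne by (auto simp: inj_on_def)
  qed (use far b v ne assms(3,4) in auto)
next
  case True
  then obtain t where t: "t \<in> V" "ht t = 0" "pos t = 3" "c t = 2" by blast
  note b = clash_bounds[OF assms(1)] clash_bounds[OF assms(2)]
  have short: "pos u \<le> 4" if "u \<in> V" for u
    using run_432_ends[of y' y t 1 u] b t assms that by simp
  have ne: "y \<noteq> y'" "y \<noteq> t" "y' \<noteq> t" "t \<noteq> v" "y \<noteq> v" "y' \<noteq> v"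
    using assms b t v by auto
  have W: "u \<in> V \<and> u \<noteq> v \<and> u \<noteq> y \<and> u \<noteq> y' \<and> u \<noteq> t" if "u \<in> V - {v, y, y', t}" for u
    using that by auto
  have cols: "pos u \<noteq> 0 \<and> pos u \<noteq> 1 \<and> pos u \<noteq> 2 \<and> pos u \<noteq> 3 \<and> pos u \<noteq> -1"
    if "u \<in> V - {v, y, y', t}" "c u \<noteq> 1" "c u \<noteq> 3" for u
    using column_of_v[of u] column_of_coloured[of y u] column_of_coloured[of y' u]
      column_of_coloured[of x u] column_of_coloured[of t u] W[OF that(1)] b t ne assms that(2,3)
    by (cases "u = x") auto
  have far_y': "2 < frame_dist pos ht u y'" if "u \<in> V - {v, y, y', t}" "c u = 2" for u
  proof -
    have u: "u \<in> V" using W[OF that(1)] by blast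
    have "0 < pos u \<Longrightarrow> 2 < \<bar>pos u - 3\<bar> + ht u"
      using same_side_right[of t u] W[OF that(1)] t that(2) by simp
    then show ?thesis
      using cols[of u] that ht_cases[OF u] short[OF u] assms(9,10) unfolding frame_dist_def by arith
  qed
  have far_t: "4 < frame_dist pos ht u t" if "u \<in> V - {v, y, y', t}" "c u = 4" for u
  proof -
    have u: "u \<in> V" using W[OF that(1)] by blast
    have "0 < pos u \<Longrightarrow> 4 < \<bar>pos u - 1\<bar> + ht u"
      using same_side_right[of y' u] W[OF that(1)] b assms that(2) by simp
    then show ?thesis
      using cols[of u] that ht_cases[OF u] short[OF u] t unfolding frame_dist_def by arith
  qed
  show ?thesis
  proof (rule recolour_witnesses[OF assms(1,2)])
    show "inj_on ((\<lambda>_. 0 :: nat)(y' := 2, t := 4, y := 6, v := 5)) {v, y, y', t}"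
      using ne by (auto simp: inj_on_def)
  qed (use far_y' far_t t b v ne assms(3,4) in auto)
qed

text \<open>
  The right neighbour \<open>z\<close> of \<open>v\<close> has colour \<open>1\<close>, and both right ends of the clashes are neighbours of
  \<open>z\<close>. If \<open>z\<close> gets colour \<open>5\<close>, its leaves can get colour \<open>1\<close>, and \<open>6\<close> at position \<open>2\<close> removes the last
  possible clash. The vertex \<open>v\<close> gets colour \<open>2\<close>: on the left the colours \<open>3, 4\<close> keep the old colour \<open>2\<close>
  away, and on the right no vertex within distance \<open>2\<close> of \<open>v\<close> keeps an old colour other than \<open>1\<close>.
\<close>

lemma clash_34_light_recolour:
  assumes "clash x y" "clash x' y'" "c x = 3" "c x' = 4" "pos x = -1" "ht x = 0"
    and "pos x' = -2" "ht x' = 0"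
    and z: "z \<in> V" "pos z = 1" "ht z = 0" "c z = 1"
    and "pos y = 1 \<or> pos y = 2 \<and> ht y = 0" "pos y' = 1 \<or> pos y' = 2 \<and> ht y' = 0"
  shows "\<exists>c'. proper pos ht 6 V c'"
proof -
  note b = clash_bounds[OF assms(1)] clash_bounds[OF assms(2)]
  define W where "W = {u \<in> V. u \<noteq> v \<and> pos u \<noteq> 1 \<and> \<not> (pos u = 2 \<and> ht u = 0)}"
  define L where "L = {u \<in> V. pos u = 1 \<and> u \<noteq> z}"
  define c1 where "c1 u = (if pos u = 1 then 1 else c u)" for u
  have zv: "z \<noteq> v" using z v by auto
  have L: "ht u = 1" if "u \<in> L" for u
    using that ht_cases[of u] spine_inj[of u z] z by (auto simp: L_def)
  have W: "proper pos ht 6 W c"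
    by (rule proper_without_witnesses[OF assms(1,2)]) (use assms in \<open>auto simp: W_def\<close>)
  have leaf_far: "1 < frame_dist pos ht u w" if "u \<in> L" "w \<in> W \<union> L" "u \<noteq> w" for u w
  proof -
    have "pos w \<noteq> 1 \<or> ht w = 1" using that(2) L by (auto simp: W_def)
    moreover have "ht w = 0 \<or> ht w = 1" using that(2) ht_cases by (auto simp: W_def L_def)
    moreover have "pos u = 1" using that(1) by (simp add: L_def)
    ultimately show ?thesis using L[OF that(1)] unfolding frame_dist_def by arith
  qed
  have c1: "proper pos ht 6 (W \<union> L) c1"
    unfolding proper_def
  proof (intro conjI ballI impI)
    show "c1 ` (W \<union> L) \<subseteq> {1..6}"
      using W by (auto simp: proper_def c1_def L_def)
  next
    fix u w assume u: "u \<in> W \<union> L" and w: "w \<in> W \<union> L" and uw: "u \<noteq> w \<and> c1 u = c1 w"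
    consider "u \<in> L" | "w \<in> L" | "u \<in> W" "w \<in> W" using u w by blast
    then show "int (c1 u) < frame_dist pos ht u w"
    proof cases
      case 1
      then have "c1 u = 1" by (simp add: c1_def L_def)
      then show ?thesis using leaf_far[OF 1 w] uw by simp
    next
      case 2
      then have "c1 w = 1" by (simp add: c1_def L_def)
      moreover have "1 < frame_dist pos ht w u" using leaf_far[OF 2 u] uw by blast
      ultimately show ?thesis using uw frame_dist_commute[of pos ht u w] by simp
    next
      case 3
      then have eq: "c1 u = c u" "c1 w = c w" by (auto simp: c1_def W_def)
      then have "c u = c w" using uw by simp
      then have "int (c u) < frame_dist pos ht u w" using W 3 uw unfolding proper_def by blast
      then show ?thesis using eq(1) by simp
    qed
  qed
  have c1_cases: "c1 u = 1 \<or> u \<in> W \<and> c1 u = c u" if "u \<in> W \<union> L" for u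
    using that by (auto simp: c1_def L_def W_def)
  have c1_le: "c1 u \<noteq> 5 \<and> c1 u \<noteq> 6" if "u \<in> W \<union> L" for u
    using c1_cases[OF that] fresh_colours[of u] by (auto simp: W_def)
  \<comment> \<open>The spine may end at \<open>z\<close>: the set \<open>B\<close> has one element or none.\<close>
  define B where "B = {u \<in> V. pos u = 2 \<and> ht u = 0}"
  obtain c2 where c2: "proper pos ht 6 (B \<union> (W \<union> L)) c2"
    and c2_old: "\<And>u. u \<in> W \<union> L \<Longrightarrow> c2 u = c1 u" and c2_new: "\<And>u. u \<in> B \<Longrightarrow> c2 u = 6"
  proof (cases "B = {}")
    case True
    show ?thesis by (rule that[of c1]) (use True c1 in auto)
  next
    case False
    then obtain t where t: "t \<in> B" by blast
    then have B: "B = {t}" using spine_inj by (auto simp: B_def)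
    have t': "t \<notin> W \<union> L" using t by (auto simp: W_def L_def B_def)
    have "proper pos ht 6 (insert t (W \<union> L)) (c1(t := 6))"
      by (rule proper_insert[OF c1 t']) (use c1_le in auto)
    then show ?thesis by (intro that[of "c1(t := 6)"]) (use B t' in auto)
  qed
  have c2_le: "c2 u \<noteq> 5" if "u \<in> B \<union> (W \<union> L)" for u
    using that c2_old[of u] c2_new[of u] c1_le[of u] by auto
  have 1: "proper pos ht 6 (insert z (B \<union> (W \<union> L))) (c2(z := 5))"
    by (rule proper_insert[OF c2]) (use c2_le z in \<open>auto simp: W_def L_def B_def\<close>)
  have far: "2 < frame_dist pos ht u v" if "u \<in> B \<union> (W \<union> L)" "c2 u = 2" for u
  proof -
    have "u \<in> W" "c u = 2"
      using that c2_old[of u] c2_new[of u] c1_cases[of u] by auto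
    then have u: "u \<in> V" "u \<noteq> v" "u \<noteq> x" "u \<noteq> x'" "c u = 2" "pos u \<noteq> 1" "\<not> (pos u = 2 \<and> ht u = 0)"
      using assms(3,4) by (auto simp: W_def)
    have "pos u \<noteq> -1" using column_of_coloured[of x u] b assms(3-8) u by simp
    moreover have "pos u \<noteq> -2" using column_of_coloured[of x' u] b assms(3-8) u by simp
    moreover have "pos u \<noteq> 0" using column_of_v[of u] u by simp
    ultimately show ?thesis
      using ht_cases[OF u(1)] u v unfolding frame_dist_def by arith
  qed
  have V: "V = insert v (insert z (B \<union> (W \<union> L)))"
    using v z by (auto simp: W_def L_def B_def)
  have vz: "v \<notin> insert z (B \<union> (W \<union> L))" using v zv by (auto simp: W_def L_def B_def)
  have far': "2 < frame_dist pos ht u v" if "u \<in> insert z (B \<union> (W \<union> L))" "(c2(z := 5)) u = 2" for u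
    using that far[of u] by (auto split: if_splits)
  have "proper pos ht 6 V ((c2(z := 5))(v := 2))"
    unfolding V by (rule proper_insert[OF 1 vz]) (use far' in auto)
  then show ?thesis by blast
qed

text \<open>
  If the left neighbour of \<open>v\<close> has the clashing colour \<open>3\<close> and the right neighbour \<open>z\<close> has not, then the
  right end of that clash is at distance \<open>2\<close>, as a leaf of \<open>z\<close> or at position \<open>2\<close>, and the colour of \<open>z\<close>
  decides between the two previous repairs. If it is not \<open>1\<close>, the leaves of \<open>z\<close> have colour \<open>1\<close>, and the
  clashes force the colours \<open>4, 3\<close> at positions \<open>1, 2\<close>.
\<close>

lemma clash_34_recolour:
  assumes "clash x y" "clash x' y'" "c x = 3" "c x' = 4" "pos x = -1" "ht x = 0"
    and not_near: "\<not> (pos y = 1 \<and> ht y = 0)"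
  shows "\<exists>c'. proper pos ht 6 V c'"
proof -
  note b = clash_bounds[OF assms(1)] clash_bounds[OF assms(2)]
  have y: "pos y = 1 \<and> ht y = 1 \<or> pos y = 2 \<and> ht y = 0"
    using b assms(3,5,6) not_near by arith
  have "x' \<noteq> x" using assms(3,4) by auto
  then have "pos x' \<noteq> -1" using column_of_coloured[of x x'] b assms(3-6) by simp
  then have x': "2 \<le> ht x' - pos x'" "pos x' \<le> -2" using b by linarith+
  then have y': "pos y' = 1 \<or> pos y' = 2 \<and> ht y' = 0" using b assms(4) by arith
  obtain z where z: "z \<in> V" "ht z = 0" "pos z = 1"
    using spine_between[OF v(1) b(2), of 1] v b by auto
  have zv: "z \<noteq> v" using z v by auto
  show ?thesis
  proof (cases "c z = 1")
    case True
    have "y' \<noteq> z" using True b assms(4) by auto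
    then have "pos y' = 1 \<Longrightarrow> ht y' = 1" using spine_inj[OF b(14) z(1)] z ht_cases[OF b(14)] by auto
    then have "pos x' = -2" "ht x' = 0" using x' y' b assms(4) by arith+
    then show ?thesis
      using clash_34_light_recolour[OF assms(1-6) _ _ z(1,3,2) True _ y'] y by blast
  next
    case False
    have yz: "y \<noteq> z" using z not_near by auto
    then have "pos y \<noteq> 1" using column_of_coloured[of z y] z zv False b assms(3) by simp
    then have y2: "pos y = 2" "ht y = 0" using y by auto
    have "y' \<noteq> y" using b assms(3,4) by auto
    then have "pos y' = 1" using spine_inj[of y' y] y2 y' b by auto
    moreover have "y' = z"
      using column_of_coloured[of z y'] z zv False b assms(4) calculation by auto
    ultimately show ?thesis
      using clash_34_tail_recolour[OF assms(1-6) y2] z by simp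
  qed
qed

text \<open>
  The remaining cases are mirror images of the previous ones.
\<close>

lemma two_clashes_recolour:
  assumes "clash x y" "clash x' y'" "c x < c x'"
  shows "\<exists>c'. proper pos ht 6 V c'"
proof -
  note b = clash_bounds[OF assms(1)] clash_bounds[OF assms(2)]
  have c4: "c x' = 4" using two_clash_colours(1)[OF assms] .
  interpret r: cut_frame V "\<lambda>u. - pos u" ht v c k by (rule reflect_cut)
  have r: "r.clash y x" "r.clash y' x'" using assms(1,2) clash_reflect by simp_all
  consider "c x = 2" | "c x = 3" using two_clash_colours(2)[OF assms] by blast
  then show ?thesis
  proof cases
    case 1
    note s = clash_2_shape[OF assms(1) 1]
    show ?thesis
    proof (cases "\<exists>z\<in>V. ht z = 0 \<and> \<bar>pos z\<bar> = 3 \<and> c z = 3")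
      case False
      show ?thesis
        by (rule adjacent_clash_recolour[OF assms(1,2) s, of 3]) (use False 1 c4 in auto)
    next
      case True
      then obtain z where z: "z \<in> V" "ht z = 0" "\<bar>pos z\<bar> = 3" "c z = 3" by blast
      show ?thesis
      proof (cases "pos z = 3")
        case True
        then show ?thesis using clash_24_recolour_with_3[OF assms(1,2) 1 c4 z(1,2) _ z(4)] by blast
      next
        case False
        then have "- pos z = 3" using z(3) by arith
        then show ?thesis
          using r.clash_24_recolour_with_3[OF r _ _ z(1,2) _ z(4)] b 1 c4 by (simp add: proper_reflect)
      qed
    qed
  next
    case 2
    have near: "pos x = -1 \<and> ht x = 0 \<or> pos y = 1 \<and> ht y = 0" using b 2 by arith
    show ?thesis
    proof (cases "pos x = -1 \<and> ht x = 0 \<and> pos y = 1 \<and> ht y = 0")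
      case True
      show ?thesis
        by (rule adjacent_clash_recolour[OF assms(1,2), of 2]) (use True 2 c4 in auto)
    next
      case False
      show ?thesis
      proof (cases "pos x = -1 \<and> ht x = 0")
        case True
        then show ?thesis using clash_34_recolour[OF assms(1,2) 2 c4] False by blast
      next
        case far: False
        then have "pos y = 1" "ht y = 0" using near by blast+
        then show ?thesis
          using r.clash_34_recolour[OF r] far b 2 c4 by (simp add: proper_reflect)
      qed
    qed
  qed
qed

lemma glue: "\<exists>c'. proper pos ht (k + 2) V c'"
proof (cases "\<exists>x y x' y'. clash x y \<and> clash x' y' \<and> c x < c x'")
  case True
  then obtain x y x' y' where *: "clash x y" "clash x' y'" "c x < c x'" by blast
  have "k = 4" by (rule two_clash_colours(3)[OF *])
  then show ?thesis using two_clashes_recolour[OF *] by simp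
next
  case False
  show ?thesis
  proof (rule one_clash_colour)
    fix x y x' y' assume *: "clash x y" "clash x' y'"
    have "\<not> c x < c x'" "\<not> c x' < c x" using False * by blast+
    then show "c x = c x'" by simp
  qed
qed

end

section \<open>Reinserting a spine vertex\<close>

context caterpillar_frame
begin

text \<open>
  Moving \<open>v\<close> to position \<open>0\<close> and giving colour \<open>1\<close> to every leaf whose neighbour is \<open>v\<close> or has another
  colour establishes the normalised situation. These leaves are the \<open>light\<close> ones below. They stay at
  distance more than \<open>1\<close> from every other vertex of colour \<open>1\<close>.
\<close>

lemma glue_at_spine_vertex:
  assumes v: "v \<in> V" "ht v = 0" and k: "k \<le> 4"
    and colour: "\<And>u. \<lbrakk>u \<in> V; u \<noteq> v\<rbrakk> \<Longrightarrow> 1 \<le> c u \<and> c u \<le> k"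
    and same_side: "\<And>u w. \<lbrakk>u \<in> V; w \<in> V; u \<noteq> w; c u = c w;
        pos u < pos v \<and> pos w < pos v \<or> pos v < pos u \<and> pos v < pos w\<rbrakk>
      \<Longrightarrow> int (c u) < frame_dist pos ht u w"
  shows "\<exists>c'. proper pos ht (k + 2) V c'"
proof -
  define light where "light u \<longleftrightarrow> ht u = 1 \<and>
    (\<exists>w\<in>V. ht w = 0 \<and> pos w = pos u \<and> (w = v \<or> c w \<noteq> 1))" for u
  define c' where "c' u = (if light u then 1 else c u)" for u
  have light_far: "1 < frame_dist pos ht u w"
    if "u \<in> V" "w \<in> V" "u \<noteq> w" "light u" "c' w = 1" "pos w \<noteq> pos v" for u w
  proof (rule ccontr)
    assume "\<not> 1 < frame_dist pos ht u w"
    then have w: "pos w = pos u" "ht w = 0" 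
      using ht_cases[OF that(2)] that(4) by (auto simp: frame_dist_def light_def)
    have "light u" by fact
    then obtain s where s: "s \<in> V" "ht s = 0" "pos s = pos u" "s = v \<or> c s \<noteq> 1"
      by (auto simp: light_def)
    then have "s = w" using spine_inj[OF s(1) that(2)] w by simp
    then show False using s(4) that(5,6) w(2) by (auto simp: c'_def light_def)
  qed
  have "cut_frame V (\<lambda>u. pos u - pos v) ht v c' k"
  proof (intro cut_frame.intro cut_frame_axioms.intro shift)
    fix u assume "u \<in> V" "u \<noteq> v"
    then show "1 \<le> c' u \<and> c' u \<le> k" using colour[of u] by (auto simp: c'_def)
  next
    fix u w assume u: "u \<in> V" and w: "w \<in> V" and "u \<noteq> w" and eq: "c' u = c' w"
      and side: "pos u - pos v < 0 \<and> pos w - pos v < 0 \<or> 0 < pos u - pos v \<and> 0 < pos w - pos v"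
    have "int (c' u) < frame_dist pos ht u w"
    proof -
      consider "light u" | "light w" | "\<not> light u" "\<not> light w" by blast
      then show ?thesis
      proof cases
        case 1
        then have "c' u = 1" by (simp add: c'_def)
        moreover have "1 < frame_dist pos ht u w"
          by (rule light_far[OF u w \<open>u \<noteq> w\<close> 1]) (use eq calculation side in linarith)+
        ultimately show ?thesis by simp
      next
        case 2
        then have "c' w = 1" by (simp add: c'_def)
        moreover have "1 < frame_dist pos ht w u"
          by (rule light_far[OF w u \<open>u \<noteq> w\<close>[symmetric] 2]) (use eq calculation side in linarith)+
        ultimately show ?thesis using eq frame_dist_commute[of pos ht u w] by simp
      next
        case 3
        then have old: "c' u = c u" "c' w = c w" by (simp_all add: c'_def)
        then have "c u = c w" using eq by simp
        then have "int (c u) < frame_dist pos ht u w"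
          by (rule same_side[OF u w \<open>u \<noteq> w\<close>]) (use side in linarith)
        then show ?thesis using old(1) by simp
      qed
    qed
    then show "int (c' u) < frame_dist (\<lambda>u. pos u - pos v) ht u w"
      by (simp add: frame_dist_def)
  next
    fix u w assume "u \<in> V" "ht u = 1" "w \<in> V" "ht w = 0" "pos w - pos v = pos u - pos v" "w = v \<or> c' w \<noteq> 1"
    then show "c' u = 1" by (auto simp: c'_def light_def split: if_splits)
  qed (use v k in simp_all)
  then have "\<exists>c'. proper (\<lambda>u. pos u - pos v) ht (k + 2) V c'" by (rule cut_frame.glue)
  then show ?thesis by (simp add: proper_def frame_dist_def)
qed

end

section \<open>Distances in a drawn caterpillar\<close>

lemma (in wf_digraph) graph_dist_le_awalk:
  assumes "awalk u p w"
  shows "graph_dist G u w \<le> enat (length p)"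
proof -
  have "awalk_cost (\<lambda>_. 1) p = real (length p)" for p :: "'b list"
    by (induction p) auto
  then have "ereal_of_enat (graph_dist G u w) \<le> ereal_of_enat (enat (length p))"
    using min_cost_le_walk_cost[OF assms, of "\<lambda>_. 1"] by (simp add: graph_dist_conv_\<mu>)
  then show ?thesis by (simp only: ereal_of_enat_le_iff)
qed

locale caterpillar_drawing = graph G + caterpillar_frame "verts G" pos ht
  for G :: "('a, 'b) pre_digraph" and pos ht +
  assumes adjacent_iff: "\<lbrakk>x \<in> verts G; y \<in> verts G\<rbrakk> \<Longrightarrow> x \<rightarrow>\<^bsub>G\<^esub> y \<longleftrightarrow> frame_dist pos ht x y = 1"
begin

text \<open>
  Along an arc the formal distance to \<open>w\<close> drops by at most \<open>1\<close>.
\<close>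

lemma frame_dist_le_length:
  assumes "awalk u p w" "u \<noteq> w"
  shows "frame_dist pos ht u w \<le> int (length p)"
  using assms
proof (induction p arbitrary: u)
  case Nil
  then show ?case by (simp add: awalk_Nil_iff)
next
  case (Cons e p)
  let ?x = "head G e"
  have e: "e \<in> arcs G" "tail G e = u" and p: "awalk ?x p w"
    using Cons.prems(1) by (auto simp: awalk_Cons_iff)
  have V: "u \<in> verts G" "?x \<in> verts G" using e by auto
  have "u \<rightarrow>\<^bsub>G\<^esub> ?x" using e by (auto simp: arcs_ends_conv)
  then have 1: "frame_dist pos ht u ?x = 1" using adjacent_iff[OF V] by simp
  show ?case
  proof (cases "?x = w")
    case True
    then show ?thesis using 1 by simp
  next
    case False
    then have "frame_dist pos ht ?x w \<le> int (length p)" using Cons.IH[OF p] by simp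
    then show ?thesis using 1 ht_cases[OF V(2)] unfolding frame_dist_def by auto
  qed
qed

lemma frame_dist_le_graph_dist:
  assumes "u \<noteq> w" "int i < frame_dist pos ht u w"
  shows "enat i < graph_dist G u w"
proof -
  have "enat (Suc i) \<le> graph_dist G u w"
    unfolding graph_dist_def
  proof (rule INF_greatest)
    fix p assume "p \<in> {p. apath u p w}"
    then have "frame_dist pos ht u w \<le> int (length p)"
      using frame_dist_le_length[OF _ assms(1)] by (auto simp: apath_def)
    then show "enat (Suc i) \<le> enat (length p)" using assms(2) by simp
  qed
  then show ?thesis by (simp add: Suc_ile_eq)
qed

lemma packing_coloring_if_proper:
  assumes "proper pos ht k (verts G) c"
  shows "packing_coloring G k c"
  unfolding packing_coloring_def
proof (intro conjI ballI impI)
  show "c ` verts G \<subseteq> {1..k}" using assms by (simp add: proper_def)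
  fix i u w assume "u \<in> verts G" "w \<in> verts G" and *: "u \<noteq> w \<and> c u = i \<and> c w = i"
  then have "int (c u) < frame_dist pos ht u w" using assms unfolding proper_def by metis
  then show "enat i < graph_dist G u w" using frame_dist_le_graph_dist * by blast
qed

lemma awalk_del_vert_step:
  assumes "x \<in> verts G" "y \<in> verts G" "frame_dist pos ht x y = 1" "x \<noteq> v" "y \<noteq> v"
    and "pre_digraph.awalk (del_vert v) y p w"
  shows "\<exists>q. pre_digraph.awalk (del_vert v) x q w \<and> length q = Suc (length p)"
proof -
  interpret H: fin_digraph "del_vert v" by (rule fin_digraph_del_vert)
  have "x \<rightarrow>\<^bsub>G\<^esub> y" using assms(1-3) adjacent_iff by blast
  then obtain e where e: "e \<in> arcs G" "tail G e = x" "head G e = y" by (auto simp: arcs_ends_conv)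
  then have "H.awalk x (e # p) w"
    using assms(4-6) by (simp add: H.awalk_Cons_iff del_vert_simps)
  then show ?thesis by force
qed

lemma spine_awalk_del_vert:
  assumes "x \<in> verts G" "w \<in> verts G" "ht x = 0" "ht w = 0" "nat \<bar>pos x - pos w\<bar> = n"
    and clear: "ht v = 1 \<or> pos x < pos v \<and> pos w < pos v \<or> pos v < pos x \<and> pos v < pos w"
  shows "\<exists>p. pre_digraph.awalk (del_vert v) x p w \<and> length p = n"
  using assms
proof (induction n arbitrary: x)
  case 0
  interpret H: fin_digraph "del_vert v" by (rule fin_digraph_del_vert)
  have "pos x = pos w" using 0 by auto
  then have "x = w" using spine_inj 0 by blast
  moreover have "w \<noteq> v" using 0 by auto
  ultimately have "H.awalk x [] w" using 0 by (simp add: H.awalk_Nil_iff del_vert_simps)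
  then show ?case by fastforce
next
  case (Suc n)
  define j where "j = (if pos x < pos w then pos x + 1 else pos x - 1)"
  have j: "pos x \<le> j \<and> j \<le> pos w \<or> pos w \<le> j \<and> j \<le> pos x" "nat \<bar>j - pos w\<bar> = n" "\<bar>pos x - j\<bar> = 1"
    using Suc.prems(5) by (auto simp: j_def)
  obtain y where y: "y \<in> verts G" "ht y = 0" "pos y = j"
    using j(1) spine_between[of x w j] spine_between[of w x j] Suc.prems(1,2) by blast
  have cy: "ht v = 1 \<or> pos y < pos v \<and> pos w < pos v \<or> pos v < pos y \<and> pos v < pos w"
    using Suc.prems(6) j(1) y(3) by auto
  obtain p where p: "pre_digraph.awalk (del_vert v) y p w" "length p = n"
    using Suc.IH[OF y(1) Suc.prems(2) y(2) Suc.prems(4) _ cy] j(2) y(3) by auto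
  have "frame_dist pos ht x y = 1" using j(3) y Suc.prems by (simp add: frame_dist_def)
  moreover have "x \<noteq> v" "y \<noteq> v" using Suc.prems cy y by auto
  ultimately show ?case
    using awalk_del_vert_step[OF Suc.prems(1) y(1) _ _ _ p(1)] p(2) by auto
qed

lemma obtain_support:
  assumes "x \<in> verts G" "ht x = 1"
  obtains s where "s \<in> verts G" "ht s = 0" "pos s = pos x" "frame_dist pos ht x s = 1"
    "frame_dist pos ht s x = 1"
  using spine_between[of x x "pos x"] assms by (auto simp: frame_dist_def)

text \<open>
  Deleting \<open>v\<close> does not increase the distance of two vertices if \<open>v\<close> is a leaf or if both lie strictly
  on the same side of \<open>v\<close>: the walk from \<open>u\<close> to its spine vertex, along the spine and up to \<open>w\<close> avoids
  \<open>v\<close>, and its length is the formal distance.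
\<close>

lemma graph_dist_del_vert_le:
  assumes "u \<in> verts G" "w \<in> verts G" "u \<noteq> w" "u \<noteq> v" "w \<noteq> v"
    and clear: "ht v = 1 \<or> pos u < pos v \<and> pos w < pos v \<or> pos v < pos u \<and> pos v < pos w"
    and "enat i < graph_dist (del_vert v) u w"
  shows "int i < frame_dist pos ht u w"
proof -
  interpret H: fin_digraph "del_vert v" by (rule fin_digraph_del_vert)
  have to_spine: "\<exists>p. H.awalk x p w' \<and> int (length p) = frame_dist pos ht x w'"
    if "x \<in> verts G" "w' \<in> verts G" "x \<noteq> v" "ht w' = 0"
      "ht v = 1 \<or> pos x < pos v \<and> pos w' < pos v \<or> pos v < pos x \<and> pos v < pos w'" for x w'
  proof (cases "ht x = 0")
    case True
    then show ?thesis
      using spine_awalk_del_vert[OF that(1,2) True that(4) refl that(5)] that(4) by (auto simp: frame_dist_def)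
  next
    case False
    then have x: "ht x = 1" using ht_cases that(1) by blast
    obtain s where s: "s \<in> verts G" "ht s = 0" "pos s = pos x" "frame_dist pos ht x s = 1"
      using obtain_support[OF \<open>x \<in> verts G\<close> x] by blast
    have "\<exists>p. H.awalk s p w' \<and> length p = nat \<bar>pos s - pos w'\<bar>"
      using spine_awalk_del_vert[OF s(1) that(2) s(2) that(4) refl] s(3) that(5) by auto
    then obtain p where p: "H.awalk s p w'" "length p = nat \<bar>pos s - pos w'\<bar>" by blast
    have "s \<noteq> v" using s that(5) by auto
    then have "\<exists>q. H.awalk x q w' \<and> length q = Suc (length p)"
      using awalk_del_vert_step[OF that(1) s(1,4) that(3) _ p(1)] by blast
    then show ?thesis using p(2) s(3) x that(4) by (auto simp: frame_dist_def)
  qed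
  have "\<exists>p. H.awalk u p w \<and> int (length p) = frame_dist pos ht u w"
  proof (cases "ht w = 0")
    case True
    then show ?thesis using to_spine[OF assms(1,2,4) _ clear] by blast
  next
    case False
    then have w: "ht w = 1" using ht_cases assms(2) by blast
    obtain s where s: "s \<in> verts G" "ht s = 0" "pos s = pos w" "frame_dist pos ht s w = 1"
      using obtain_support[OF assms(2) w] by blast
    have sv: "s \<noteq> v" using s clear by auto
    obtain p where p: "H.awalk u p s" "int (length p) = frame_dist pos ht u s"
      using to_spine[OF assms(1) s(1) assms(4) s(2)] s(3) clear by auto
    have "H.awalk w [] w" using assms(2,5) by (simp add: H.awalk_Nil_iff del_vert_simps)
    then obtain q where q: "H.awalk s q w" "length q = Suc (length ([] :: 'b list))"
      using awalk_del_vert_step[OF s(1) assms(2) s(4) sv assms(5)] by blast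
    have "H.awalk u (p @ q) w" using p(1) q(1) by (rule H.awalk_appendI)
    moreover have "int (length (p @ q)) = frame_dist pos ht u w"
      using p(2) q(2) s w by (simp add: frame_dist_def)
    ultimately show ?thesis by blast
  qed
  then obtain p where p: "H.awalk u p w" "int (length p) = frame_dist pos ht u w" by blast
  then have "enat i < enat (length p)"
    using H.graph_dist_le_awalk[OF p(1)] assms(7) by order
  then show ?thesis using p(2) by simp
qed

end

section \<open>Every caterpillar has a drawing\<close>

lemma (in wf_digraph) awalk_nth:
  assumes "awalk u p v" "i < length p"
  shows "tail G (p ! i) = awalk_verts u p ! i" "head G (p ! i) = awalk_verts u p ! Suc i"
proof -
  show "tail G (p ! i) = awalk_verts u p ! i"
    using assms(2) by (auto simp: awalk_verts_conv nth_append)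
  have "cas u p v" using assms(1) by (simp add: awalk_def)
  then show "head G (p ! i) = awalk_verts u p ! Suc i"
    using assms(2) by (auto simp: awalk_verts_conv')
qed

lemma (in wf_digraph) awalk_segment:
  assumes "awalk u p v" "i + n \<le> length p"
  shows "awalk (awalk_verts u p ! i) (take n (drop i p)) (awalk_verts u p ! (i + n))"
  using assms(2)
proof (induction n)
  case 0
  have "awalk_verts u p ! i \<in> set (awalk_verts u p)" using 0 by (simp add: length_awalk_verts)
  then show ?case using assms(1) by (auto simp: awalk_Nil_iff)
next
  case (Suc n)
  then have i: "i + n < length p" by simp
  have "p ! (i + n) \<in> arcs G" using assms(1) i by (auto simp: awalk_def)
  then have "awalk (awalk_verts u p ! (i + n)) [p ! (i + n)] (awalk_verts u p ! (i + Suc n))"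
    using awalk_nth[OF assms(1) i] arc_implies_awalk by force
  moreover have "take (Suc n) (drop i p) = take n (drop i p) @ [p ! (i + n)]"
    using i by (simp add: take_Suc_conv_app_nth)
  ultimately show ?case using awalk_appendI[OF Suc.IH] i by auto
qed

text \<open>
  An arc that leads back along a path closes a cycle. In a tree this excludes all arcs between
  spine vertices except those of the spine itself and their reverses.
\<close>

lemma (in wf_digraph) apath_chord_cycle:
  assumes "apath u p v" "i < j" "j \<le> length p" "e \<in> arcs G"
    and "tail G e = awalk_verts u p ! j" "head G e = awalk_verts u p ! i"
  shows "cycle (take (j - i) (drop i p) @ [e])"
proof -
  let ?xs = "awalk_verts u p" and ?q = "take (j - i) (drop i p)"
  have p: "awalk u p v" and d: "distinct ?xs" using assms(1) by (auto simp: apath_def)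
  have cas: "cas u p v" using p by (simp add: awalk_def)
  have q: "awalk (?xs ! i) ?q (?xs ! j)" using awalk_segment[OF p, of i "j - i"] assms(2,3) by simp
  have "awalk (?xs ! j) [e] (?xs ! i)" using arc_implies_awalk[OF assms(4)] assms(5,6) by simp
  then have c: "awalk (?xs ! i) (?q @ [e]) (?xs ! i)" by (rule awalk_appendI[OF q])
  have xs: "?xs = u # map (head G) p" using awalk_verts_conv'[OF cas] cas by (cases p) auto
  have tl: "tl (awalk_verts (?xs ! i) (?q @ [e])) = map (head G) ?q @ [?xs ! i]"
    using awalk_verts_conv'[of "?xs ! i" "?q @ [e]" "?xs ! i"] c assms(6) by (auto simp: awalk_def)
  have hd: "map (head G) ?q = take (j - i) (drop (Suc i) ?xs)"
    by (subst xs) (simp add: take_map drop_map)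
  have ne: "?xs ! i \<notin> set (take (j - i) (drop (Suc i) ?xs))"
  proof
    assume "?xs ! i \<in> set (take (j - i) (drop (Suc i) ?xs))"
    then have "?xs ! i \<in> set (drop (Suc i) ?xs)" by (rule in_set_takeD)
    then obtain m where "m < length ?xs - Suc i" and "?xs ! i = ?xs ! (Suc i + m)"
      by (auto simp: in_set_conv_nth)
    moreover have "Suc i + m < length ?xs" using calculation by linarith
    ultimately show False using nth_eq_iff_index_eq[OF d, of i "Suc i + m"] by simp
  qed
  have "distinct (map (head G) ?q @ [?xs ! i])"
    unfolding hd using d ne by simp
  then show ?thesis using c tl unfolding cycle_def by (intro exI[of _ "?xs ! i"]) simp
qed

text \<open>
  The vertices of the central path are placed at their index, and every other vertex at the index of
  its neighbour \<open>nb w\<close>. A vertex off the path has degree at most one, so \<open>nb w\<close> is unique, and it lies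
  on the path: if not, it would have \<open>w\<close> as its only neighbour, and no walk would lead from \<open>w\<close> to the
  path.
\<close>

lemma caterpillar_has_drawing:
  assumes "caterpillar T"
  shows "\<exists>pos ht. caterpillar_drawing T pos ht"
proof -
  obtain u p v where g: "graph T" and con: "Digraph_Component.connected T"
    and acyc: "\<not> (\<exists>p. pre_digraph.cycle T p \<and> 3 \<le> length p)"
    and path: "pre_digraph.apath T u p v"
    and cover: "{w \<in> verts T. 2 \<le> out_degree T w} \<subseteq> set (pre_digraph.awalk_verts T u p)"
    using assms unfolding caterpillar_def undirected_tree_def by blast
  interpret graph T by (rule g)
  define xs where "xs = awalk_verts u p"
  have walk: "awalk u p v" and d: "distinct xs" using path by (auto simp: apath_def xs_def)
  have len: "length xs = Suc (length p)" by (simp add: xs_def length_awalk_verts)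
  have xsV: "set xs \<subseteq> verts T" using walk by (auto simp: xs_def)
  have u: "u \<in> set xs" using hd_in_awalk_verts(1)[OF walk] by (simp add: xs_def)
  have sym: "y \<rightarrow>\<^bsub>T\<^esub> x" if "x \<rightarrow>\<^bsub>T\<^esub> y" for x y
    using arcs_ends_symmetric[OF sym_arcs that] .
  have step: "xs ! i \<rightarrow>\<^bsub>T\<^esub> xs ! Suc i" if "i < length p" for i
    using awalk_nth[OF walk that] walk that in_arcs_imp_in_arcs_ends[of "p ! i"]
    by (auto simp: xs_def awalk_def subset_iff)
  have no_chord: "j = Suc i" if "xs ! j \<rightarrow>\<^bsub>T\<^esub> xs ! i" "i < j" "j < length xs" for i j
  proof (rule ccontr)
    assume "j \<noteq> Suc i"
    obtain e where e: "e \<in> arcs T" "tail T e = xs ! j" "head T e = xs ! i"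
      using \<open>xs ! j \<rightarrow>\<^bsub>T\<^esub> xs ! i\<close> by (rule reachableE)
    have "cycle (take (j - i) (drop i p) @ [e])"
      by (rule apath_chord_cycle[OF path that(2)]) (use e that(3) len in \<open>auto simp: xs_def\<close>)
    moreover have "3 \<le> length (take (j - i) (drop i p) @ [e])"
      using \<open>j \<noteq> Suc i\<close> that(2,3) len by auto
    ultimately show False using acyc by blast
  qed
  have one_arc: "y = y'" if "w \<in> verts T" "w \<notin> set xs" "w \<rightarrow>\<^bsub>T\<^esub> y" "w \<rightarrow>\<^bsub>T\<^esub> y'" for w y y'
  proof -
    obtain e where e: "e \<in> out_arcs T w" "head T e = y"
      using \<open>w \<rightarrow>\<^bsub>T\<^esub> y\<close> by (elim reachableE) auto
    obtain e' where e': "e' \<in> out_arcs T w" "head T e' = y'"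
      using \<open>w \<rightarrow>\<^bsub>T\<^esub> y'\<close> by (elim reachableE) auto
    have "card (out_arcs T w) \<le> Suc 0"
      using cover that(1,2) by (force simp: out_degree_def xs_def)
    then have "e = e'" using e(1) e'(1) card_le_Suc0_iff_eq[OF finite_out_arcs] by blast
    then show ?thesis using e(2) e'(2) by simp
  qed
  have nb_ex: "\<exists>y\<in>set xs. w \<rightarrow>\<^bsub>T\<^esub> y" if w: "w \<in> verts T" "w \<notin> set xs" for w
  proof (rule ccontr)
    assume none: "\<not> (\<exists>y\<in>set xs. w \<rightarrow>\<^bsub>T\<^esub> y)"
    have "w \<rightarrow>\<^sup>*\<^bsub>T\<^esub> u"
      using con w u xsV reachable_mk_symmetric_eq[OF sym_arcs]
      by (auto simp: connected_def strongly_connected_def)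
    then have "u = w \<or> w \<rightarrow>\<^bsub>T\<^esub> u"
    proof (induction rule: reachable_induct)
      case base
      show ?case by simp
    next
      case (step x y)
      show ?case
      proof (cases "x = w")
        case True
        then show ?thesis using step by simp
      next
        case False
        then have wx: "w \<rightarrow>\<^bsub>T\<^esub> x" using step by blast
        then have "x \<in> verts T" "x \<notin> set xs" using none adj_in_verts by blast+
        then have "y = w" using one_arc[OF _ _ step(2) sym[OF wx]] by blast
        then show ?thesis by simp
      qed
    qed
    then show False using none u w by blast
  qed
  define nb where "nb w = (if w \<in> set xs then w else SOME y. y \<in> set xs \<and> w \<rightarrow>\<^bsub>T\<^esub> y)" for w
  define pos where "pos w = int (the_inv_into {..<length xs} ((!) xs) (nb w))" for w
  define ht :: "'a \<Rightarrow> int" where "ht w = (if w \<in> set xs then 0 else 1)" for w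
  have inj: "inj_on ((!) xs) {..<length xs}" using d by (simp add: inj_on_nth)
  have nb_off: "nb w \<in> set xs \<and> w \<rightarrow>\<^bsub>T\<^esub> nb w" if "w \<in> verts T" "w \<notin> set xs" for w
    using someI_ex[of "\<lambda>y. y \<in> set xs \<and> w \<rightarrow>\<^bsub>T\<^esub> y"] nb_ex[OF that] that by (auto simp: nb_def)
  have nb_in: "nb w \<in> set xs" if "w \<in> verts T" for w
    using nb_off[OF that] by (cases "w \<in> set xs") (auto simp: nb_def)
  have pos_nth: "pos (xs ! i) = int i" if "i < length xs" for i
    using that the_inv_into_f_f[OF inj, of i] by (simp add: pos_def nb_def)
  have pos_ex: "\<exists>i<length xs. pos w = int i \<and> nb w = xs ! i" if "w \<in> verts T" for w
  proof -
    have "nb w \<in> set xs" by (rule nb_in[OF that])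
    then obtain i where i: "i < length xs" "xs ! i = nb w" by (auto simp: in_set_conv_nth)
    moreover have "pos w = int i" using the_inv_into_f_f[OF inj, of i] i by (simp add: pos_def)
    ultimately show ?thesis by auto
  qed
  have pos_eq: "nb x = nb y" if "x \<in> verts T" "y \<in> verts T" "pos x = pos y" for x y
    using pos_ex[OF that(1)] pos_ex[OF that(2)] that(3) by auto
  interpret caterpillar_frame "verts T" pos ht
  proof
    show "ht w = 0 \<or> ht w = 1" for w by (simp add: ht_def)
    show "x = y" if "x \<in> verts T" "y \<in> verts T" "ht x = 0" "ht y = 0" "pos x = pos y" for x y
      using pos_eq[OF that(1,2,5)] that(3,4) by (simp add: ht_def nb_def split: if_splits)
    show "\<exists>z\<in>verts T. ht z = 0 \<and> pos z = j"
      if "x \<in> verts T" "y \<in> verts T" "pos x \<le> j" "j \<le> pos y" for x y j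
    proof -
      have "0 \<le> j" "j < int (length xs)" using pos_ex[OF that(1)] pos_ex[OF that(2)] that(3,4) by auto
      then obtain i where i: "j = int i" "i < length xs" using nonneg_int_cases by fastforce
      then have "xs ! i \<in> set xs" by simp
      then show ?thesis using pos_nth[OF i(2)] i(1) xsV by (intro bexI[of _ "xs ! i"]) (auto simp: ht_def)
    qed
  qed
  have "x \<rightarrow>\<^bsub>T\<^esub> y \<longleftrightarrow> frame_dist pos ht x y = 1" if x: "x \<in> verts T" and y: "y \<in> verts T" for x y
  proof -
    have leaf: "a \<rightarrow>\<^bsub>T\<^esub> b \<longleftrightarrow> frame_dist pos ht a b = 1"
      if "a \<in> verts T" "a \<notin> set xs" "b \<in> verts T" for a b
    proof -
      have *: "a \<rightarrow>\<^bsub>T\<^esub> b \<longleftrightarrow> b = nb a"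
        using nb_off[OF that(1,2)] one_arc[OF that(1,2)] by blast
      show ?thesis
      proof (cases "b \<in> set xs")
        case True
        have "b = nb a \<longleftrightarrow> pos a = pos b"
        proof
          assume "b = nb a"
          then show "pos a = pos b" using True by (simp add: pos_def nb_def)
        next
          assume "pos a = pos b"
          then show "b = nb a" using pos_eq[OF that(1,3)] True by (simp add: nb_def)
        qed
        then show ?thesis using * True that(2) by (simp add: frame_dist_def ht_def)
      next
        case False
        then show ?thesis using * nb_in[OF that(1)] that(2) by (auto simp: frame_dist_def ht_def)
      qed
    qed
    show ?thesis
    proof (cases "x \<in> set xs \<and> y \<in> set xs")
      case True
      then obtain i j where i: "i < length xs" "xs ! i = x" and j: "j < length xs" "xs ! j = y"
        by (auto simp: in_set_conv_nth)
      have "x \<rightarrow>\<^bsub>T\<^esub> y \<longleftrightarrow> j = Suc i \<or> i = Suc j"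
      proof
        assume xy: "x \<rightarrow>\<^bsub>T\<^esub> y"
        then have "i \<noteq> j" using adj_not_same i j by auto
        then show "j = Suc i \<or> i = Suc j"
          using no_chord[of i j] no_chord[of j i] xy sym[OF xy] i j by (cases "i < j") auto
      next
        assume "j = Suc i \<or> i = Suc j"
        then show "x \<rightarrow>\<^bsub>T\<^esub> y" using step[of i] step[of j] sym i j len by auto
      qed
      then show ?thesis
        using True pos_nth[OF i(1)] pos_nth[OF j(1)] i j by (auto simp: frame_dist_def ht_def)
    next
      case False
      then show ?thesis
        using leaf[OF x _ y] leaf[OF y _ x] sym frame_dist_commute[of pos ht x y] by metis
    qed
  qed
  then have "caterpillar_drawing T pos ht" by unfold_locales
  then show ?thesis by blast
qed

section \<open>The packing coloring gap\<close>

lemma (in caterpillar_drawing) chromatic_number_le: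
  assumes v: "v \<in> verts G"
  shows "packing_chromatic_number G \<le> packing_chromatic_number (del_vert v) + 2"
proof -
  define k where "k = packing_chromatic_number (del_vert v)"
  interpret H: fin_digraph "del_vert v" by (rule fin_digraph_del_vert)
  obtain c where c: "packing_coloring (del_vert v) k c"
    using LeastI_ex[OF H.packing_coloring_exists] unfolding k_def packing_chromatic_number_def by blast
  have colour: "1 \<le> c u \<and> c u \<le> k" if "u \<in> verts G" "u \<noteq> v" for u
    using c that by (auto simp: packing_coloring_def del_vert_simps)
  have apart: "int (c u) < frame_dist pos ht u w"
    if "u \<in> verts G" "w \<in> verts G" "u \<noteq> w" "u \<noteq> v" "w \<noteq> v" "c u = c w"
      "ht v = 1 \<or> pos u < pos v \<and> pos w < pos v \<or> pos v < pos u \<and> pos v < pos w" for u w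
  proof (rule graph_dist_del_vert_le[OF that(1-5,7)])
    have "u \<in> verts (del_vert v)" "w \<in> verts (del_vert v)" "c u \<in> {1..k}"
      using that(1,2,4,5) colour by (auto simp: del_vert_simps)
    then show "enat (c u) < graph_dist (del_vert v) u w"
      using c that(3,6) unfolding packing_coloring_def by metis
  qed
  have "\<exists>c'. proper pos ht (k + 2) (verts G) c'"
  proof -
    consider "ht v = 1" | "ht v = 0" "k \<le> 4" | "5 \<le> k" using ht_cases[OF v] by linarith
    then show ?thesis
    proof cases
      \<comment> \<open>Deleting a leaf preserves all other distances, so one new colour is enough.\<close>
      case 1
      have "c u \<in> {1..k}" if "u \<in> verts G - {v}" for u
        using colour[of u] that by simp
      moreover have "int (c u) < frame_dist pos ht u w"
        if "u \<in> verts G - {v}" "w \<in> verts G - {v}" "u \<noteq> w" "c u = c w" for u w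
        using apart[of u w] that 1 by simp
      ultimately have "proper pos ht k (verts G - {v}) c" unfolding proper_def by blast
      then have old: "proper pos ht (k + 2) (verts G - {v}) c" by (rule proper_mono) simp
      have "proper pos ht (k + 2) (insert v (verts G - {v})) (c(v := k + 1))"
      proof (rule proper_insert[OF old])
        fix u assume "u \<in> verts G - {v}" "c u = k + 1"
        then show "int (k + 1) < frame_dist pos ht u v" using colour[of u] by simp
      qed simp_all
      then show ?thesis using v by (metis insert_Diff)
    next
      case 2
      show ?thesis
      proof (rule glue_at_spine_vertex[OF v 2])
        show "1 \<le> c u \<and> c u \<le> k" if "u \<in> verts G" "u \<noteq> v" for u using colour that .
        show "int (c u) < frame_dist pos ht u w"
          if "u \<in> verts G" "w \<in> verts G" "u \<noteq> w" "c u = c w"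
            "pos u < pos v \<and> pos w < pos v \<or> pos v < pos u \<and> pos v < pos w" for u w
          using apart[OF that(1-3) _ _ that(4)] that(5) by auto
      qed
    next
      case 3
      obtain c' where "proper pos ht 7 (verts G) c'" using seven_colours by blast
      then have "proper pos ht (k + 2) (verts G) c'" by (rule proper_mono) (use 3 in simp)
      then show ?thesis by blast
    qed
  qed
  then obtain c' where "packing_coloring G (k + 2) c'" using packing_coloring_if_proper by blast
  then have "packing_chromatic_number G \<le> k + 2"
    unfolding packing_chromatic_number_def by (intro Least_le exI)
  then show ?thesis by (simp add: k_def)
qed

theorem theorem1:
  fixes T :: "('a, 'b) pre_digraph"
  assumes "caterpillar T"
  shows "packing_coloring_gap T \<le> 2"
proof -
  obtain pos ht where "caterpillar_drawing T pos ht"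
    using caterpillar_has_drawing[OF assms] by blast
  then interpret caterpillar_drawing T pos ht .
  have "verts T \<noteq> {}"
    using assms awalk_hd_in_verts
    unfolding caterpillar_def apath_def by blast
  moreover have "int (packing_chromatic_number T) - int (packing_chromatic_number (del_vert v)) \<le> 2"
    if "v \<in> verts T" for v
    using chromatic_number_le[OF that] by linarith
  ultimately show ?thesis
    unfolding packing_coloring_gap_def by (subst Max_le_iff) auto
qed

end
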